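(* For $N\in\{3,4\}$ define $h_N:\mathbb Z^N\to\mathbb R$ by $h_N(0)=0$ and, for $n\neq 0$, $$h_3(n)=\left(|n|^2+\tfrac{75}{64}\right)^{-1/4},\qquad h_4(n)=\left(|n|^2+\tfrac{17}{8}\right)^{-1/2},$$ and set $$V_N(n):=\frac{(-\Delta_d h_N)(n)}{h_N(n)}-\frac{A_N}{|n|^2},\qquad n\in X_N=\mathbb Z^N\setminus\{0\}.$$ Then $V_N(n)>0$ for every $n\in X_N$, and $$\mathcal E_N[u]-A_N\mathcal D_N[u]\ge\sum_{n\in X_N}V_N(n)|u(n)|^2$$ for every finitely supported $u:\mathbb Z^N\to\mathbb C$ with $u(0)=0$. Thus the form $u\mapsto \mathcal E_N[u]-A_N\mathcal D_N[u]$ is subcritical, although $C(N)=A_N$. In particular, $A_N|n|^{-2}$ is not a pointwise optimal Hardy weight.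
   Context: Let $e_1,\dots,e_N$ be the standard basis of $\mathbb Z^N$, $|n|$ the Euclidean norm, $A_N=(N-2)^2/4$, and $(\Delta_d f)(n)=\sum_{j=1}^N(f(n+e_j)+f(n-e_j)-2f(n))$. For finitely supported $u:\mathbb Z^N\to\mathbb C$ with $u(0)=0$, $$\mathcal E_N[u]=\sum_{j=1}^N\sum_{n\in\mathbb Z^N}|u(n+e_j)-u(n)|^2,\qquad \mathcal D_N[u]=\sum_{n\ne0}\frac{|u(n)|^2}{|n|^2},$$ and $C(N)$ is the infimum of $\mathcal E_N[u]/\mathcal D_N[u]$ over all such $u\ne0$. A nonnegative form $Q$ on such $u$ is called subcritical if there is a nonzero nonnegative weight $V$ on $X_N$ with $Q[u]\ge\sum_n V(n)|u(n)|^2$ for every finitely supported $u$ with $u(0)=0$. A Hardy weight is a function $W\ge 0$ on $X_N$ with $\mathcal E_N[u]\ge\sum_{n\in X_N}W(n)|u(n)|^2$ for all such $u$; it is not pointwise optimal if there is a Hardy weight $\widetilde W\ge W$ with $\widetilde W\ne W$. *)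

theory Defs
  imports "HOL-Analysis.Analysis"
begin

text \<open>
  The lattice \<open>\<int>\<^sup>N\<close> is \<^typ>\<open>int ^ 'd\<close> with \<open>N = CARD('d)\<close>. All infinite sums below are
  only evaluated at functions of finite support, so they have finitely many nonzero terms and
  the convention that \<^const>\<open>infsum\<close> of a non-summable family is 0 never matters.
\<close>

definition unit_vec :: "'d::finite \<Rightarrow> int ^ 'd" where
  "unit_vec j = axis j 1"

text \<open>The integers are not a real normed space, so the norm is taken after embedding into
  \<^typ>\<open>real ^ 'd\<close>.\<close>

definition eucl_norm :: "int ^ 'd::finite \<Rightarrow> real" where
  "eucl_norm n = norm ((\<chi> i. real_of_int (n $ i)) :: real ^ 'd)"

definition punctured_lattice :: "(int ^ 'd::finite) set" where
  "punctured_lattice = UNIV - {0}"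

definition discrete_laplacian :: "(int ^ 'd::finite \<Rightarrow> real) \<Rightarrow> int ^ 'd \<Rightarrow> real" where
  "discrete_laplacian f n =
     (\<Sum>j\<in>UNIV. f (n + unit_vec j) + f (n - unit_vec j) - 2 * f n)"

definition test_functions :: "(int ^ 'd::finite \<Rightarrow> complex) set" where
  "test_functions = {u. finite {n. u n \<noteq> 0} \<and> u 0 = 0}"

definition energy :: "(int ^ 'd::finite \<Rightarrow> complex) \<Rightarrow> real" where
  "energy u = (\<Sum>j\<in>UNIV. \<Sum>\<^sub>\<infinity>n\<in>UNIV. (cmod (u (n + unit_vec j) - u n))\<^sup>2)"

definition weighted_mass :: "(int ^ 'd::finite \<Rightarrow> real) \<Rightarrow> (int ^ 'd \<Rightarrow> complex) \<Rightarrow> real" where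
  "weighted_mass W u = (\<Sum>\<^sub>\<infinity>n\<in>punctured_lattice. W n * (cmod (u n))\<^sup>2)"

definition hardy_term :: "(int ^ 'd::finite \<Rightarrow> complex) \<Rightarrow> real" where
  "hardy_term u = (\<Sum>\<^sub>\<infinity>n\<in>punctured_lattice. (cmod (u n))\<^sup>2 / (eucl_norm n)\<^sup>2)"

definition hardy_const :: "'d::finite itself \<Rightarrow> real" where
  "hardy_const _ =
     Inf {energy u / hardy_term u | u :: int ^ 'd \<Rightarrow> complex. u \<in> test_functions \<and> u \<noteq> (\<lambda>_. 0)}"

definition A_const :: "nat \<Rightarrow> real" where
  "A_const N = (real N - 2)\<^sup>2 / 4"

text \<open>Quadratic form of a Hermitian sesquilinear form (linear in the first argument) on the
  test functions.\<close>

definition quadratic_form :: "((int ^ 'd::finite \<Rightarrow> complex) \<Rightarrow> real) \<Rightarrow> bool" where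
  "quadratic_form Q \<longleftrightarrow>
     (\<exists>B :: (int ^ 'd \<Rightarrow> complex) \<Rightarrow> (int ^ 'd \<Rightarrow> complex) \<Rightarrow> complex.
        (\<forall>u\<in>test_functions. \<forall>v\<in>test_functions. \<forall>w\<in>test_functions. \<forall>a b.
           B (\<lambda>n. a * u n + b * v n) w = a * B u w + b * B v w) \<and>
        (\<forall>u\<in>test_functions. \<forall>v\<in>test_functions. B v u = cnj (B u v)) \<and>
        (\<forall>u\<in>test_functions. complex_of_real (Q u) = B u u))"

definition nonneg_form :: "((int ^ 'd::finite \<Rightarrow> complex) \<Rightarrow> real) \<Rightarrow> bool" where
  "nonneg_form Q \<longleftrightarrow> quadratic_form Q \<and> (\<forall>u\<in>test_functions. 0 \<le> Q u)"

text \<open>Weights live on the punctured lattice; their value at the origin is irrelevant, so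
  nonnegativity, ordering and being different are all tested away from the origin.\<close>

definition subcritical :: "((int ^ 'd::finite \<Rightarrow> complex) \<Rightarrow> real) \<Rightarrow> bool" where
  "subcritical Q \<longleftrightarrow> nonneg_form Q \<and>
     (\<exists>V. (\<forall>n\<in>punctured_lattice. 0 \<le> V n) \<and> (\<exists>n\<in>punctured_lattice. V n \<noteq> 0) \<and>
          (\<forall>u\<in>test_functions. weighted_mass V u \<le> Q u))"

definition hardy_weight :: "(int ^ 'd::finite \<Rightarrow> real) \<Rightarrow> bool" where
  "hardy_weight W \<longleftrightarrow> (\<forall>n\<in>punctured_lattice. 0 \<le> W n) \<and>
     (\<forall>u\<in>test_functions. weighted_mass W u \<le> energy u)"

definition pointwise_optimal :: "(int ^ 'd::finite \<Rightarrow> real) \<Rightarrow> bool" where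
  "pointwise_optimal W \<longleftrightarrow>
     \<not> (\<exists>W'. hardy_weight W' \<and> (\<forall>n\<in>punctured_lattice. W n \<le> W' n) \<and>
             (\<exists>n\<in>punctured_lattice. W' n \<noteq> W n))"

definition h3 :: "int ^ 'd::finite \<Rightarrow> real" where
  "h3 n = (if n = 0 then 0 else ((eucl_norm n)\<^sup>2 + 75 / 64) powr (- 1 / 4))"

definition h4 :: "int ^ 'd::finite \<Rightarrow> real" where
  "h4 n = (if n = 0 then 0 else ((eucl_norm n)\<^sup>2 + 17 / 8) powr (- 1 / 2))"

definition remainder_weight :: "(int ^ 'd::finite \<Rightarrow> real) \<Rightarrow> int ^ 'd \<Rightarrow> real" where
  "remainder_weight h n =
     (- discrete_laplacian h n) / h n - A_const CARD('d) / (eucl_norm n)\<^sup>2"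

end

theory Submission
  imports Defs
begin

text \<open>
  Everything rests on a supersolution, in the spirit of the ground state representation. If
  \<open>h > 0\<close> off the origin and \<open>h 0 = 0\<close>, then expanding squares edge by edge shows that the
  energy of \<open>u\<close> equals the weighted mass of \<open>u\<close> with weight \<open>- \<Delta> h / h\<close> plus a sum of squares
  (\<open>ground_state_identity\<close>). So \<open>- \<Delta> h / h\<close> is a Hardy weight, and the theorem follows once this
  weight is strictly larger than \<open>A / |n|\<^sup>2\<close> everywhere and the constant \<open>A\<close> is seen to be
  sharp.

  Pointwise inequality (\<open>lap_quot_gt\<close>). Both profiles have the form \<open>(|n|\<^sup>2 + c) powr - a\<close> with
  \<open>N = 4 a + 2\<close> and \<open>A = 4 a\<^sup>2\<close>. Put \<open>m = |n|\<^sup>2\<close> and \<open>q = 1 / (m + c + 1)\<close>. The two neighbours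
  of \<open>n\<close> in direction \<open>j\<close> contribute the even function \<open>(1 + y) powr - a + (1 - y) powr - a\<close> at
  \<open>y = 2 n\<^sub>j q\<close>, up to the common factor \<open>(1 - q) powr a\<close>. This function is a power series in
  \<open>y\<^sup>2\<close> with nonnegative coefficients, and the numbers \<open>y\<^sup>2\<close> have the sum \<open>4 m q\<^sup>2\<close>, which
  depends on \<open>m\<close> alone; by convexity the worst points of each sphere are those on a coordinate
  axis. What remains is an inequality in the single variable \<open>m\<close>. On the axes the expansion of
  \<open>- \<Delta> h / h - A / m\<close> in powers of \<open>1 / m\<close> has no term of order \<open>1 / m\<close>, and the shifts \<open>75/64\<close>
  and \<open>17/8\<close> are exactly those for which the term of order \<open>1 / m\<^sup>2\<close> vanishes as well. So the
  estimates must be exact to second order, and they are: after truncating the series with an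
  error of third order, the claim for \<open>m \<ge> 2\<close> says that a polynomial in \<open>m - 2\<close> is positive, and
  all its coefficients are positive (\<open>axis_inequality_3\<close>, \<open>axis_inequality_4\<close>). At the points
  with \<open>m = 1\<close> one neighbour is the origin, where \<open>h\<close> vanishes, and this gains so much that
  crude bounds suffice.

  Sharpness (\<open>almost_extremal\<close>). The same expansion gives \<open>- \<Delta> h / h = A / m + O(1 / m\<^sup>2)\<close>.
  Multiply \<open>h\<close> by a cutoff that decreases like \<open>1 - H\<^sub>k / H\<^sub>M\<close> in the sup norm \<open>k\<close>, with
  harmonic numbers in the place of logarithms. Since the shell of sup norm \<open>k\<close> has about
  \<open>k ^ (N - 1)\<close> points, the sum of squares in the ground state identity stays bounded and so
  does the contribution of the error term up to a small multiple of the Hardy term, while the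
  Hardy term itself grows like a harmonic series. Hence the quotient of energy and Hardy term
  comes arbitrarily close to \<open>A\<close>.
\<close>

section \<open>Binomial series estimates\<close>

lemma binomial_series_neg:
  fixes a z :: real
  assumes "\<bar>z\<bar> < 1"
  shows "(\<lambda>k. pochhammer a k / fact k * z ^ k) sums (1 - z) powr (- a)"
proof -
  have "(\<lambda>k. ((- a) gchoose k) * (- z) ^ k) sums (1 + (- z)) powr (- a)"
    using assms by (intro gen_binomial_real) auto
  moreover have "((- a) gchoose k) * (- z) ^ k = pochhammer a k / fact k * z ^ k" for k
  proof -
    have "(- 1) ^ k * (- z) ^ k = z ^ k" by (simp flip: power_mult_distrib)
    thus ?thesis by (simp add: gbinomial_pochhammer mult.left_commute mult.commute)
  qed
  ultimately show ?thesis by simp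
qed

text \<open>
  All coefficients of \<open>(1 - q) powr a\<close> of positive order are nonpositive, so every truncation is
  an upper bound; stopping after the second order costs an error of order \<open>q\<^sup>3\<close>.
\<close>
lemma one_minus_powr_upper:
  fixes a q :: real
  assumes a: "0 < a" "a < 1" and q: "0 \<le> q" "q < 1"
  shows "(1 - q) powr a \<le> 1 - a * q - a * (1 - a) / 2 * q\<^sup>2"
proof -
  let ?c = "\<lambda>k. pochhammer (- a) k / fact k * q ^ k"
  have s: "?c sums (1 - q) powr a"
    using binomial_series_neg[of q "- a"] q by simp
  have neg: "?c k \<le> 0" if k3: "k \<ge> 3" for k
  proof -
    obtain i where k: "k = Suc i" using k3 by (cases k) auto
    have "pochhammer (- a) k = - a * pochhammer (1 - a) i"
      unfolding k by (simp add: pochhammer_rec)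
    moreover have "pochhammer (1 - a) i \<ge> 0"
      using a by (intro pochhammer_nonneg) auto
    ultimately have "pochhammer (- a) k \<le> 0" using a by (simp add: mult_nonneg_nonneg)
    thus ?thesis using q by (auto intro!: mult_nonpos_nonneg divide_nonpos_pos)
  qed
  have "(1 - q) powr a = (\<Sum>k. ?c k)" using s by (simp add: sums_iff)
  also have "- (\<Sum>k. ?c k) = (\<Sum>k. - ?c k)"
    using s by (simp add: sums_iff suminf_minus)
  also have "(\<Sum>k<3. - ?c k) \<le> (\<Sum>k. - ?c k)"
    using s neg by (intro sum_le_suminf summable_minus) (auto simp: sums_iff)
  finally have "(1 - q) powr a \<le> (\<Sum>k<3. ?c k)" by (simp add: sum_negf)
  also have "\<dots> = 1 - a * q - a * (1 - a) / 2 * q\<^sup>2"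
    by (simp add: numeral_3_eq_3 numeral_2_eq_2 pochhammer_Suc)
  finally show ?thesis .
qed

text \<open>
  The odd powers cancel. The neighbours \<open>n + e\<^sub>j\<close> and \<open>n - e\<^sub>j\<close> always enter together, through
  this combination.
\<close>
lemma even_part_series:
  fixes a y :: real
  assumes "\<bar>y\<bar> < 1"
  shows "(\<lambda>k. 2 * (pochhammer a (2 * k) / fact (2 * k) * y ^ (2 * k))) sums
    ((1 + y) powr (- a) + (1 - y) powr (- a))"
proof -
  let ?f = "\<lambda>k. pochhammer a k / fact k * (- y) ^ k + pochhammer a k / fact k * y ^ k"
  have "?f sums ((1 - (- y)) powr (- a) + (1 - y) powr (- a))"
    using assms by (intro sums_add binomial_series_neg) auto
  hence "?f sums ((1 + y) powr (- a) + (1 - y) powr (- a))" by simp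
  moreover have "?f k = 0" if "k \<notin> range ((*) 2)" for k
  proof -
    have "odd k" using that by (auto elim: evenE)
    thus ?thesis by simp
  qed
  moreover have "strict_mono ((*) (2::nat))" by (simp add: strict_mono_def)
  ultimately have "(\<lambda>k. ?f (2 * k)) sums ((1 + y) powr (- a) + (1 - y) powr (- a))"
    by (subst sums_mono_reindex) auto
  thus ?thesis by (simp flip: mult_2)
qed

lemma even_part_lower:
  fixes a y :: real
  assumes "0 < a" "\<bar>y\<bar> < 1"
  shows "2 + a * (a + 1) * y\<^sup>2 \<le> (1 + y) powr (- a) + (1 - y) powr (- a)"
proof -
  let ?f = "\<lambda>k. 2 * (pochhammer a (2 * k) / fact (2 * k) * y ^ (2 * k))"
  note s = even_part_series[OF assms(2), of a]
  have "(\<Sum>k<2. ?f k) \<le> (\<Sum>k. ?f k)"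
    using s assms by (intro sum_le_suminf) (auto simp: sums_iff intro!: pochhammer_nonneg mult_nonneg_nonneg divide_nonneg_pos)
  moreover have "(\<Sum>k<2. ?f k) = 2 + a * (a + 1) * y\<^sup>2"
    by (simp add: lessThan_Suc numeral_2_eq_2 pochhammer_Suc)
  ultimately show ?thesis using s by (simp only: sums_iff)
qed

lemma pochhammer_over_fact_antimono:
  fixes a :: real
  assumes "0 < a" "a \<le> 1" "i \<le> k"
  shows "pochhammer a k / fact k \<le> pochhammer a i / fact i"
  using assms(3)
proof (induction k rule: dec_induct)
  case (step k)
  have "pochhammer a (Suc k) / fact (Suc k) = pochhammer a k / fact k * ((a + k) / (1 + k))"
    by (simp add: pochhammer_Suc mult.commute)
  also have "\<dots> \<le> pochhammer a k / fact k * 1"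
  proof (rule mult_left_mono)
    show "(a + k) / (1 + k) \<le> 1" using assms by (simp add: divide_le_eq_1)
    show "0 \<le> pochhammer a k / fact k"
      using assms by (intro divide_nonneg_pos pochhammer_nonneg) auto
  qed
  finally show ?case using step.IH by simp
qed simp

text \<open>
  The terms up to \<open>y ^ 4\<close> are kept exactly. Since the coefficients decrease for \<open>a \<le> 1\<close>, the
  rest is dominated by a geometric series in \<open>y\<^sup>2\<close>.
\<close>
lemma even_part_upper:
  fixes a y :: real
  assumes a: "0 < a" "a \<le> 1" and y: "\<bar>y\<bar> < 1"
  shows "(1 + y) powr (- a) + (1 - y) powr (- a) \<le>
    2 * (1 + pochhammer a 2 / fact 2 * y\<^sup>2 + pochhammer a 4 / fact 4 * y ^ 4
           + pochhammer a 6 / fact 6 * (y ^ 6 / (1 - y\<^sup>2)))"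
proof -
  let ?p = "\<lambda>k. pochhammer a (2 * k) / fact (2 * k)"
  let ?f = "\<lambda>k. 2 * (?p k * y ^ (2 * k))"
  have s: "?f sums ((1 + y) powr (- a) + (1 - y) powr (- a))"
    by (rule even_part_series[OF y])
  have "y\<^sup>2 < 1" using y by (simp add: abs_square_less_1)
  hence "(\<lambda>k. (y\<^sup>2) ^ k) sums (1 / (1 - y\<^sup>2))"
    by (intro geometric_sums) simp
  hence geom: "(\<lambda>k. 2 * ?p 3 * y ^ 6 * (y\<^sup>2) ^ k) sums (2 * ?p 3 * y ^ 6 * (1 / (1 - y\<^sup>2)))"
    by (intro sums_mult)
  have tail: "(\<lambda>k. ?f (k + 3)) sums ((1 + y) powr (- a) + (1 - y) powr (- a) - (\<Sum>k<3. ?f k))"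
    using s by (subst sums_iff_shift) simp
  have le: "?f (k + 3) \<le> 2 * ?p 3 * y ^ 6 * (y\<^sup>2) ^ k" for k
  proof -
    have "?p (k + 3) * y ^ (2 * (k + 3)) \<le> ?p 3 * y ^ (2 * (k + 3))"
      using a by (intro mult_right_mono pochhammer_over_fact_antimono zero_le_even_power) auto
    moreover have "y ^ (2 * (k + 3)) = y ^ 6 * (y\<^sup>2) ^ k"
      unfolding power_mult[symmetric] power_add[symmetric] by (simp add: algebra_simps)
    ultimately have "2 * (?p (k + 3) * y ^ (2 * (k + 3))) \<le> 2 * (?p 3 * (y ^ 6 * (y\<^sup>2) ^ k))"
      by (metis mult_left_mono zero_le_numeral)
    thus ?thesis by (simp only: mult.assoc)
  qed
  have "(1 + y) powr (- a) + (1 - y) powr (- a) - (\<Sum>k<3. ?f k)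
      \<le> 2 * ?p 3 * y ^ 6 * (1 / (1 - y\<^sup>2))"
    by (rule sums_le[OF le tail geom])
  moreover have "{..<3} = {0, 1, 2::nat}" by auto
  hence "(\<Sum>k<3. ?f k) = 2 * (1 + pochhammer a 2 / fact 2 * y\<^sup>2 + pochhammer a 4 / fact 4 * y ^ 4)"
    by simp
  ultimately show ?thesis by auto
qed

section \<open>The one-variable inequalities on the coordinate axes\<close>

text \<open>
  Here \<open>q\<close> and \<open>Z\<close> are functions of \<open>m = |n|\<^sup>2\<close>, the fractions \<open>5/32\<close>, \<open>195/2048\<close> and
  \<open>4641/65536\<close> are the Taylor coefficients of \<open>(1 - z) powr - 1/4\<close> of orders 2, 4 and 6, and
  \<open>3/32\<close> is minus that of \<open>(1 - q) powr 1/4\<close> of order 2. Clearing denominators gives a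
  polynomial of formal degree 9 in \<open>m\<close> whose top three coefficients cancel: the first because
  there are \<open>2 N = 6\<close> neighbours, the second because of the choice of \<open>A\<close>, the third because of
  the choice of the shift \<open>75/64\<close>.
\<close>
lemma axis_inequality_3:
  fixes m q Z :: real
  assumes m: "m \<ge> 2" and q: "q = 1 / (m + 75/64 + 1)" and Z: "Z = 4 * m * q\<^sup>2"
  shows "(1 - 1/4 * q - 3/32 * q\<^sup>2) *
           (6 + 2 * (5/32 * Z + 195/2048 * Z\<^sup>2 + 4641/65536 * (Z ^ 3 / (1 - Z))))
         < 6 - 1/4 / m"
proof -
  (* The variable s = 64 (m - 2) is nonnegative, and p = 64 / q and w = 64 m make all
     coefficients integers. *)
  define s p w d where "s = 64 * m - 128" and "p = s + 267" and "w = s + 128"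
    and "d = p\<^sup>2 - 256 * w"
  have pos: "s \<ge> 0" "p > 0" "w > 0" using m by (auto simp: s_def p_def w_def)
  have "d = (s + 278) * s + 38521"
    unfolding d_def p_def w_def by algebra
  hence d: "d > 0" using pos by (simp add: add_nonneg_pos)
  have mw: "m = w / 64" and qp: "q = 64 / p" by (simp_all add: q w_def p_def s_def field_simps)
  have Zw: "Z = 256 * w / p\<^sup>2" and Z1: "1 - Z = d / p\<^sup>2"
    using pos by (simp_all add: Z mw qp d_def field_simps power2_eq_square)
  define U where "U = p\<^sup>2 - 16 * p - 384"
  define B where "B = 6 * p ^ 4 * d + 80 * w * p\<^sup>2 * d + 12480 * w\<^sup>2 * d + 2376192 * w ^ 3"
  have "(6 * w - 16) * (p ^ 6 * d) - w * (U * B) = 127212514058363329008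
      + 3404943884720531616 * s
      + 35958670592374800 * s ^ 2
      + 198792835019456 * s ^ 3
      + 625695588880 * s ^ 4
      + 1091267744 * s ^ 5
      + 836592 * s ^ 6"
    unfolding U_def B_def d_def unfolding p_def w_def by algebra
  also have "\<dots> > 0" using pos by (intro add_pos_nonneg) auto
  finally have G: "w * (U * B) < (6 * w - 16) * (p ^ 6 * d)" by simp
  have "1 - 1/4 * q - 3/32 * q\<^sup>2 = U / p\<^sup>2"
    using pos by (simp add: qp U_def field_simps power2_eq_square)
  moreover have "6 + 2 * (5/32 * Z + 195/2048 * Z\<^sup>2 + 4641/65536 * (Z ^ 3 / (1 - Z))) = B / (p ^ 4 * d)"
    unfolding Z1 unfolding Zw using pos d
    by (simp add: B_def divide_simps) algebra
  moreover have "6 - 1/4 / m = (6 * w - 16) / w"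
    using pos by (simp add: mw field_simps)
  moreover have "U / p\<^sup>2 * (B / (p ^ 4 * d)) = U * B / (p ^ 6 * d)"
    by (simp flip: power_add)
  moreover have "U * B / (p ^ 6 * d) < (6 * w - 16) / w"
    using pos d G by (simp add: field_simps)
  ultimately show ?thesis by simp
qed

text \<open>
  The analogue for \<open>a = 1/2\<close> and the shift \<open>17/8\<close>, with the Taylor coefficients of
  \<open>(1 - z) powr - 1/2\<close> and of \<open>(1 - q) powr 1/2\<close>. The substitution is now \<open>s = 8 (m - 2)\<close>.
\<close>
lemma axis_inequality_4:
  fixes m q Z :: real
  assumes m: "m \<ge> 2" and q: "q = 1 / (m + 17/8 + 1)" and Z: "Z = 4 * m * q\<^sup>2"
  shows "(1 - 1/2 * q - 1/8 * q\<^sup>2) *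
           (8 + 2 * (3/8 * Z + 35/128 * Z\<^sup>2 + 231/1024 * (Z ^ 3 / (1 - Z))))
         < 8 - 1 / m"
proof -
  define s p w d where "s = 8 * m - 16" and "p = s + 41" and "w = s + 16"
    and "d = p\<^sup>2 - 32 * w"
  have pos: "s \<ge> 0" "p > 0" "w > 0" using m by (auto simp: s_def p_def w_def)
  have "d = (s + 50) * s + 1169"
    unfolding d_def p_def w_def by algebra
  hence d: "d > 0" using pos by (simp add: add_nonneg_pos)
  have mw: "m = w / 8" and qp: "q = 8 / p" by (simp_all add: q w_def p_def s_def field_simps)
  have Zw: "Z = 32 * w / p\<^sup>2" and Z1: "1 - Z = d / p\<^sup>2"
    using pos by (simp_all add: Z mw qp d_def field_simps power2_eq_square)
  define U where "U = p\<^sup>2 - 4 * p - 8"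
  define B where "B = 8 * p ^ 4 * d + 24 * w * p\<^sup>2 * d + 560 * w\<^sup>2 * d + 14784 * w ^ 3"
  have "(8 * w - 8) * (p ^ 6 * d) - w * (U * B) = 4575590681592
      + 1572440762656 * s
      + 145316427272 * s ^ 2
      + 6214750848 * s ^ 3
      + 140782792 * s ^ 4
      + 1666400 * s ^ 5
      + 8248 * s ^ 6"
    unfolding U_def B_def d_def unfolding p_def w_def by algebra
  also have "\<dots> > 0" using pos by (intro add_pos_nonneg) auto
  finally have G: "w * (U * B) < (8 * w - 8) * (p ^ 6 * d)" by simp
  have "1 - 1/2 * q - 1/8 * q\<^sup>2 = U / p\<^sup>2"
    using pos by (simp add: qp U_def field_simps power2_eq_square)
  moreover have "8 + 2 * (3/8 * Z + 35/128 * Z\<^sup>2 + 231/1024 * (Z ^ 3 / (1 - Z))) = B / (p ^ 4 * d)"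
    unfolding Z1 unfolding Zw using pos d
    by (simp add: B_def divide_simps) algebra
  moreover have "8 - 1 / m = (8 * w - 8) / w"
    using pos by (simp add: mw field_simps)
  moreover have "U / p\<^sup>2 * (B / (p ^ 4 * d)) = U * B / (p ^ 6 * d)"
    by (simp flip: power_add)
  moreover have "U * B / (p ^ 6 * d) < (8 * w - 8) / w"
    using pos d G by (simp add: field_simps)
  ultimately show ?thesis by simp
qed

section \<open>Squared lengths of lattice points\<close>

abbreviation nsq :: "int ^ 'd::finite \<Rightarrow> real" where
  "nsq n \<equiv> (eucl_norm n)\<^sup>2"

lemma nsq_sum: "nsq n = of_int (\<Sum>i\<in>UNIV. (n $ i)\<^sup>2)"
  unfolding eucl_norm_def power2_norm_eq_inner by (simp add: inner_vec_def power2_eq_square)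

lemma nsq_add_unit_vec: "nsq (n + unit_vec j) = nsq n + 2 * of_int (n $ j) + 1"
proof -
  have "(\<Sum>i\<in>UNIV. ((n + unit_vec j) $ i)\<^sup>2)
      = (\<Sum>i\<in>UNIV. (n $ i)\<^sup>2 + (if i = j then 2 * n $ j + 1 else 0))"
    by (intro sum.cong) (auto simp: unit_vec_def axis_def power2_eq_square algebra_simps)
  also have "\<dots> = (\<Sum>i\<in>UNIV. (n $ i)\<^sup>2) + (2 * n $ j + 1)"
    by (simp add: sum.distrib)
  finally show ?thesis unfolding nsq_sum by simp
qed

lemma nsq_diff_unit_vec: "nsq (n - unit_vec j) = nsq n - 2 * of_int (n $ j) + 1"
  using nsq_add_unit_vec[of "n - unit_vec j" j] by (simp add: unit_vec_def)

lemma nsq_0 [simp]: "nsq 0 = 0"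
  unfolding nsq_sum by simp

lemma nsq_eq_0_iff [simp]: "nsq n = 0 \<longleftrightarrow> n = 0"
proof
  assume "nsq n = 0"
  hence "norm ((\<chi> i. real_of_int (n $ i)) :: real ^ 'a) = 0" by (simp add: eucl_norm_def)
  thus "n = 0" by (simp add: vec_eq_iff)
qed auto

lemma nsq_ge_1: "n \<noteq> 0 \<Longrightarrow> nsq n \<ge> 1"
proof -
  assume "n \<noteq> 0"
  hence "nsq n > 0" using nsq_eq_0_iff[of n] by (simp add: order_less_le)
  moreover obtain k :: int where "nsq n = of_int k" using nsq_sum by blast
  ultimately show ?thesis by simp
qed

lemma nsq_eq_1:
  assumes "n \<noteq> 0" "nsq n < 2"
  shows "nsq n = 1"
proof -
  obtain k :: int where "nsq n = of_int k" using nsq_sum by blast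
  thus ?thesis using nsq_ge_1[OF assms(1)] assms(2) by simp
qed

lemma coord_sq_le_nsq: "(of_int (n $ j))\<^sup>2 \<le> nsq n"
proof -
  have "(n $ j)\<^sup>2 \<le> (\<Sum>i\<in>UNIV. (n $ i)\<^sup>2)" by (rule member_le_sum) auto
  hence "of_int ((n $ j)\<^sup>2) \<le> nsq n" unfolding nsq_sum of_int_le_iff .
  thus ?thesis by simp
qed

lemma neighbour_nonzero:
  assumes "nsq n \<ge> 2"
  shows "n + unit_vec j \<noteq> 0" "n - unit_vec j \<noteq> 0"
proof -
  show "n + unit_vec j \<noteq> 0"
  proof
    assume "n + unit_vec j = 0"
    hence "n = 0 - unit_vec j" by (metis add_diff_cancel_right')
    thus False using assms by (simp only: nsq_diff_unit_vec) simp
  qed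
  show "n - unit_vec j \<noteq> 0"
  proof
    assume "n - unit_vec j = 0"
    hence "n = 0 + unit_vec j" by simp
    thus False using assms by (simp only: nsq_add_unit_vec) simp
  qed
qed

text \<open>
  Replacing \<open>m\<close> by \<open>m + k\<close> changes \<open>1 / m\<close> only to the next order; this is the error made when
  the shift \<open>c + 1\<close> is ignored in the upper bound for the Hardy weight.
\<close>
lemma inverse_square_shift_estimate:
  fixes m k :: real
  assumes "m > 0" "k \<ge> 0"
  shows "1 / m - m / (m + k)\<^sup>2 \<le> 2 * k / m\<^sup>2"
proof -
  have "2 * k / m\<^sup>2 - (1 / m - m / (m + k)\<^sup>2) = (3 * k\<^sup>2 * m + 2 * k ^ 3) / (m\<^sup>2 * (m + k)\<^sup>2)"
    using assms by (simp add: divide_simps) algebra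
  also have "\<dots> \<ge> 0" using assms by simp
  finally show ?thesis by simp
qed

section \<open>The weight generated by the profile\<close>

text \<open>
  Both dimensions at once: in either case \<open>N = 4 a + 2\<close> and \<open>A_const N = 4 a\<^sup>2\<close>, so that nearly
  all arguments can be carried out in terms of \<open>a\<close>.
\<close>
locale hardy_profile =
  fixes h :: "int ^ 'd::finite \<Rightarrow> real" and a c :: real
  assumes profile: "h n = (if n = 0 then 0 else (nsq n + c) powr (- a))"
    and parameters: "CARD('d) = 3 \<and> a = 1/4 \<and> c = 75/64 \<or> CARD('d) = 4 \<and> a = 1/2 \<and> c = 17/8"
begin

lemma parameter_bounds: "0 < a" "a \<le> 1/2" "0 < c" "c \<le> 17/8"
  using parameters by auto

lemma dim_eq: "real CARD('d) = 4 * a + 2"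
  using parameters by auto

lemma A_eq: "A_const CARD('d) = 4 * a\<^sup>2"
  unfolding A_const_def dim_eq by (simp add: power2_eq_square)

lemma base_pos: "nsq n + c > 0"
  using parameter_bounds by (simp add: add_nonneg_pos)

lemma h_pos: "n \<noteq> 0 \<Longrightarrow> h n > 0"
  using base_pos[of n] by (simp add: profile)

lemma h_0: "h 0 = 0"
  by (simp add: profile)

lemma h_nonneg: "h n \<ge> 0"
  by (cases "n = 0") (auto simp: h_0 h_pos less_imp_le)

text \<open>
  The Hardy weight that the supersolution \<open>h\<close> generates; subtracting the classical weight from
  it leaves the remainder weight.
\<close>
definition lap_quot :: "int ^ 'd \<Rightarrow> real" where
  "lap_quot n = - discrete_laplacian h n / h n"

lemma lap_quot_sum:
  assumes "n \<noteq> 0"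
  shows "lap_quot n = (\<Sum>j\<in>UNIV. 2 - (h (n + unit_vec j) / h n + h (n - unit_vec j) / h n))"
  using h_pos[OF assms] unfolding lap_quot_def discrete_laplacian_def
  by (simp add: sum_divide_distrib diff_divide_distrib add_divide_distrib sum_subtractf sum.distrib algebra_simps
      flip: sum_negf)

lemma lap_quot_le_dim:
  assumes "n \<noteq> 0"
  shows "lap_quot n \<le> 2 * CARD('d)"
proof -
  have ratio: "h n' / h n \<ge> 0" for n' by (simp add: h_nonneg)
  have "lap_quot n \<le> (\<Sum>j\<in>(UNIV::'d set). 2)"
    unfolding lap_quot_sum[OF assms]
  proof (rule sum_mono)
    show "2 - (h (n + unit_vec j) / h n + h (n - unit_vec j) / h n) \<le> 2" for j
      using ratio[of "n + unit_vec j"] ratio[of "n - unit_vec j"] by linarith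
  qed
  thus ?thesis by simp
qed

lemma ratio_lt_1:
  assumes "n \<noteq> 0" "nsq n < nsq n'"
  shows "h n' / h n < 1"
proof -
  have "n' \<noteq> 0" using assms by auto
  hence "h n' < h n" using assms parameter_bounds
    by (simp add: profile powr_less_mono2_neg add_nonneg_pos)
  thus ?thesis using h_pos[OF assms(1)] by simp
qed

text \<open>
  One of the neighbours is the origin and contributes nothing. Moving by one unit changes
  \<open>|n|\<^sup>2\<close> by an odd number, so every other neighbour has \<open>|n'|\<^sup>2 \<ge> 2\<close> and a strictly smaller
  value of \<open>h\<close>. Thus the quotient exceeds 1, and \<open>A \<le> 1\<close> in both dimensions.
\<close>
lemma lap_quot_unit_sphere:
  assumes "nsq n = 1"
  shows "lap_quot n > 1"
proof -
  have n0: "n \<noteq> 0" using assms by auto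
  have even_pos: "1 < nsq n'" if "2 + 2 * of_int i = nsq n'" "n' \<noteq> 0" for i and n' :: "int ^ 'd"
  proof -
    have "1 \<le> real_of_int (2 + 2 * i)" using nsq_ge_1[of n'] that by simp
    hence "1 \<le> 2 + 2 * i" by (simp only: of_int_1_le_iff)
    hence "1 < 2 + 2 * i" by presburger
    hence "1 < real_of_int (2 + 2 * i)" by (simp only: of_int_1_less_iff)
    thus ?thesis using that(1) by simp
  qed
  have "h n' / h n < 1" if "2 + 2 * of_int i = nsq n'" for i n'
    using ratio_lt_1[OF n0, of n'] even_pos[OF that] assms by (cases "n' = 0") (auto simp: h_0)
  hence lt: "h (n + unit_vec j) / h n < 1" "h (n - unit_vec j) / h n < 1" for j
    using assms nsq_add_unit_vec[of n j] nsq_diff_unit_vec[of n j]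
    by (force intro: minus_minus simp: of_int_minus[symmetric] simp del: of_int_minus)+
  obtain j where j: "n $ j \<noteq> 0" using n0 by (auto simp: vec_eq_iff)
  have "n + unit_vec j = 0 \<or> n - unit_vec j = 0"
  proof (cases "n $ j > 0")
    case True
    hence "nsq (n - unit_vec j) \<le> 0" unfolding nsq_diff_unit_vec assms by simp
    thus ?thesis using nsq_eq_0_iff[of "n - unit_vec j"] by simp
  next
    case False
    hence "nsq (n + unit_vec j) \<le> 0" unfolding nsq_add_unit_vec assms using j by simp
    thus ?thesis using nsq_eq_0_iff[of "n + unit_vec j"] by simp
  qed
  hence "1 < 2 - (h (n + unit_vec j) / h n + h (n - unit_vec j) / h n)"
    using lt[of j] by (auto simp: h_0)
  also have "\<dots> \<le> lap_quot n"
    unfolding lap_quot_sum[OF n0] using add_strict_mono[OF lt(1) lt(2)]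
    by (intro member_le_sum) (auto simp: less_imp_le)
  finally show ?thesis .
qed

text \<open>
  The relative position \<open>y\<close> of the neighbour is measured from \<open>|n|\<^sup>2 + c + 1\<close>, the mean of
  \<open>|n'|\<^sup>2 + c\<close> over a pair of opposite neighbours \<open>n'\<close>, so that opposite neighbours get opposite
  values of \<open>y\<close>.
\<close>
lemma ratio_product:
  assumes "n \<noteq> 0" "n' \<noteq> 0" and q: "q = 1 / (nsq n + c + 1)" and y: "nsq n' + c = (nsq n + c + 1) * (1 + y)"
  shows "h n' / h n = (1 - q) powr a * (1 + y) powr (- a)"
proof -
  let ?R = "nsq n + c"
  have R: "?R > 0" using parameter_bounds by (simp add: add_nonneg_pos)
  have "nsq n' + c > 0" using parameter_bounds by (simp add: add_nonneg_pos)
  hence "1 + y > 0" using R unfolding y by (simp add: zero_less_mult_iff)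
  hence 1: "h n' = (?R + 1) powr (- a) * (1 + y) powr (- a)"
    using R assms(2) by (simp add: profile y powr_mult)
  have e: "?R = (?R + 1) * (1 - q)" and q1: "1 - q > 0" using R by (simp_all add: q field_simps)
  have "h n = (?R + 1) powr (- a) * (1 - q) powr (- a)"
    using R assms(1) q1 by (subst powr_mult[symmetric]) (auto simp: profile e[symmetric])
  thus ?thesis unfolding 1 using R q1 by (simp add: powr_minus divide_inverse)
qed

lemma lap_quot_expansion:
  assumes n: "nsq n \<ge> 2" and q: "q = 1 / (nsq n + c + 1)" 
    and y: "\<And>j. y j = 2 * of_int (n $ j) * q"
  shows "lap_quot n = 2 * CARD('d) -
      (1 - q) powr a * (\<Sum>j\<in>UNIV. (1 + y j) powr (- a) + (1 - y j) powr (- a))"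
    and "(\<Sum>j\<in>UNIV. (y j)\<^sup>2) = 4 * nsq n * q\<^sup>2"
    and "\<bar>y j\<bar> < 1"
proof -
  have n0: "n \<noteq> 0" using n by auto
  have R: "nsq n + c > 0" using parameter_bounds by (simp add: add_nonneg_pos)
  have "h (n + unit_vec j) / h n = (1 - q) powr a * (1 + y j) powr (- a)" for j
    using n0 neighbour_nonzero[OF n] R
    by (intro ratio_product q) (auto simp: nsq_add_unit_vec y q field_simps)
  moreover have "h (n - unit_vec j) / h n = (1 - q) powr a * (1 + (- y j)) powr (- a)" for j
    using n0 neighbour_nonzero[OF n] R
    by (intro ratio_product q) (auto simp: nsq_diff_unit_vec y q field_simps)
  ultimately show "lap_quot n = 2 * CARD('d) -
      (1 - q) powr a * (\<Sum>j\<in>UNIV. (1 + y j) powr (- a) + (1 - y j) powr (- a))"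
    unfolding lap_quot_sum[OF n0]
    by (simp add: sum_subtractf sum_distrib_left distrib_left)
  show "(\<Sum>j\<in>UNIV. (y j)\<^sup>2) = 4 * nsq n * q\<^sup>2"
    unfolding y nsq_sum by (simp add: power_mult_distrib sum_distrib_left sum_distrib_right)
  have "0 \<le> (\<bar>of_int (n $ j)\<bar> - (1::real))\<^sup>2" by simp
  hence "2 * \<bar>of_int (n $ j)\<bar> \<le> nsq n + (1::real)"
    using coord_sq_le_nsq[of n j] by (simp add: power2_eq_square algebra_simps)
  thus "\<bar>y j\<bar> < 1"
    using R parameter_bounds by (simp add: y q abs_mult)
qed

lemma axis_inequality:
  assumes "m \<ge> 2" "q = 1 / (m + c + 1)" "Z = 4 * m * q\<^sup>2"
  shows "(1 - a * q - a * (1 - a) / 2 * q\<^sup>2) *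
      (2 * CARD('d) + 2 * (pochhammer a 2 / fact 2 * Z + pochhammer a 4 / fact 4 * Z\<^sup>2
         + pochhammer a 6 / fact 6 * (Z ^ 3 / (1 - Z))))
      < 2 * CARD('d) - A_const CARD('d) / m"
proof -
  from parameters show ?thesis
  proof (elim disjE conjE)
    assume N: "CARD('d) = 3" and a: "a = 1/4" and c: "c = 75/64"
    have coeffs: "pochhammer a 2 / fact 2 = 5/32" "pochhammer a 4 / fact 4 = 195/2048"
      "pochhammer a 6 / fact 6 = 4641/65536" "a * (1 - a) / 2 = 3/32" "4 * a\<^sup>2 = 1/4"
      by (simp_all add: a eval_nat_numeral pochhammer_Suc)
    show ?thesis using axis_inequality_3[of m q Z] assms unfolding A_eq coeffs unfolding N c a by simp
  next
    assume N: "CARD('d) = 4" and a: "a = 1/2" and c: "c = 17/8"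
    have coeffs: "pochhammer a 2 / fact 2 = 3/8" "pochhammer a 4 / fact 4 = 35/128"
      "pochhammer a 6 / fact 6 = 231/1024" "a * (1 - a) / 2 = 1/8" "4 * a\<^sup>2 = 1"
      by (simp_all add: a eval_nat_numeral pochhammer_Suc)
    show ?thesis using axis_inequality_4[of m q Z] assms unfolding A_eq coeffs unfolding N c a by simp
  qed
qed

text \<open>
  For \<open>|n|\<^sup>2 \<ge> 2\<close> all neighbours avoid the origin. Each \<open>y\<^sub>j\<^sup>2\<close> is at most their sum \<open>Z\<close>;
  bounding all but one factor \<open>y\<^sub>j\<^sup>2\<close> of the higher powers by \<open>Z\<close> and summing over \<open>j\<close> leaves
  the value that the bound of \<open>even_part_upper\<close> takes when a single \<open>y\<^sub>j\<close> is nonzero, that is,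
  on a coordinate axis.
\<close>
lemma lap_quot_gt:
  assumes "n \<noteq> 0"
  shows "A_const CARD('d) / nsq n < lap_quot n"
proof (cases "nsq n \<ge> 2")
  case False
  have "nsq n = 1" using nsq_eq_1[OF assms] False by simp
  moreover have "A_const CARD('d) \<le> 1"
    using parameter_bounds power_mono[of a "1/2" 2] by (simp add: A_eq power2_eq_square)
  ultimately show ?thesis using lap_quot_unit_sphere[of n] by simp
next
  case True
  define q where "q = 1 / (nsq n + c + 1)"
  define y where "y j = 2 * of_int (n $ j) * q" for j
  define Z where "Z = 4 * nsq n * q\<^sup>2"
  define p where "p k = pochhammer a k / fact k" for k
  let ?S = "\<Sum>j\<in>UNIV. (1 + y j) powr (- a) + (1 - y j) powr (- a)"
  note expan = lap_quot_expansion[OF True q_def y_def]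
  have q: "0 < q" "q < 1" using True parameter_bounds by (simp_all add: q_def)
  have p: "p k \<ge> 0" for k using parameter_bounds by (simp add: p_def pochhammer_nonneg)
  have Zsum: "(\<Sum>j\<in>UNIV. (y j)\<^sup>2) = Z" using expan(2) by (simp add: Z_def)
  have "(nsq n + c + 1)\<^sup>2 > 4 * nsq n"
  proof -
    have "(nsq n + c + 1)\<^sup>2 - 4 * nsq n = (nsq n - 1)\<^sup>2 + c * (2 * nsq n + 2 + c)"
      by (simp add: power2_eq_square algebra_simps)
    also have "\<dots> > 0" using True parameter_bounds by (intro add_nonneg_pos) auto
    finally show ?thesis by simp
  qed
  hence Z: "0 \<le> Z" "Z < 1"
    using True parameter_bounds by (simp_all add: Z_def q_def power_one_over divide_less_eq)
  have yZ: "(y j)\<^sup>2 \<le> Z" for j unfolding Zsum[symmetric] by (rule member_le_sum) auto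
  have "(1 + y j) powr (- a) + (1 - y j) powr (- a) \<le>
      2 + 2 * (p 2 + p 4 * Z + p 6 * (Z\<^sup>2 / (1 - Z))) * (y j)\<^sup>2" for j
  proof -
    have y1: "(y j)\<^sup>2 < 1" using yZ[of j] Z by simp
    have y4: "y j ^ 4 \<le> Z * (y j)\<^sup>2"
      using mult_right_mono[OF yZ[of j], of "(y j)\<^sup>2"] by (simp flip: power_add)
    have "(y j ^ 4) \<le> Z\<^sup>2"
      using power_mono[OF yZ[of j], of 2] by (simp flip: power_mult)
    hence "y j ^ 4 / (1 - (y j)\<^sup>2) \<le> Z\<^sup>2 / (1 - Z)"
      using yZ[of j] Z by (intro frac_le) auto
    hence "y j ^ 4 / (1 - (y j)\<^sup>2) * (y j)\<^sup>2 \<le> Z\<^sup>2 / (1 - Z) * (y j)\<^sup>2"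
      by (rule mult_right_mono) simp
    hence y6: "y j ^ 6 / (1 - (y j)\<^sup>2) \<le> Z\<^sup>2 / (1 - Z) * (y j)\<^sup>2"
      by (simp flip: power_add)
    have "(1 + y j) powr (- a) + (1 - y j) powr (- a) \<le>
        2 * (1 + p 2 * (y j)\<^sup>2 + p 4 * y j ^ 4 + p 6 * (y j ^ 6 / (1 - (y j)\<^sup>2)))"
      unfolding p_def using parameter_bounds expan(3) by (intro even_part_upper) auto
    also have "\<dots> \<le> 2 * (1 + p 2 * (y j)\<^sup>2 + p 4 * (Z * (y j)\<^sup>2) + p 6 * (Z\<^sup>2 / (1 - Z) * (y j)\<^sup>2))"
      using y4 y6 p by (intro mult_left_mono add_mono) auto
    finally show ?thesis by (simp add: algebra_simps)
  qed
  hence "?S \<le> (\<Sum>j\<in>(UNIV :: 'd set). 2 + 2 * (p 2 + p 4 * Z + p 6 * (Z\<^sup>2 / (1 - Z))) * (y j)\<^sup>2)"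
    by (intro sum_mono) auto
  also have "\<dots> = 2 * CARD('d) + 2 * (p 2 * Z + p 4 * Z\<^sup>2 + p 6 * (Z ^ 3 / (1 - Z)))"
    unfolding sum.distrib sum_distrib_left[symmetric] Zsum
    by (simp add: algebra_simps power2_eq_square power3_eq_cube)
  finally have S: "?S \<le> 2 * CARD('d) + 2 * (p 2 * Z + p 4 * Z\<^sup>2 + p 6 * (Z ^ 3 / (1 - Z)))" .
  have U: "(1 - q) powr a \<le> 1 - a * q - a * (1 - a) / 2 * q\<^sup>2"
    using parameter_bounds q by (intro one_minus_powr_upper) auto
  have "(1 - q) powr a * ?S \<le> (1 - a * q - a * (1 - a) / 2 * q\<^sup>2) *
      (2 * CARD('d) + 2 * (p 2 * Z + p 4 * Z\<^sup>2 + p 6 * (Z ^ 3 / (1 - Z))))"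
    using order_trans[OF powr_ge_zero U] by (intro mult_mono U S) (auto intro: sum_nonneg)
  also have "\<dots> < 2 * CARD('d) - A_const CARD('d) / nsq n"
    unfolding p_def by (rule axis_inequality[OF True q_def Z_def])
  finally show ?thesis unfolding expan(1) by simp
qed

text \<open>
  First-order lower bounds for both factors of the expansion suffice here: their errors are of
  order \<open>1 / |n| ^ 4\<close>, and the terms of order \<open>1 / |n|\<^sup>2\<close> combine to \<open>A\<close> since
  \<open>2 N a - 4 a (a + 1) = 4 a\<^sup>2\<close>. The constant 24 is generous.
\<close>
lemma lap_quot_upper:
  assumes "n \<noteq> 0"
  shows "lap_quot n \<le> A_const CARD('d) / nsq n + 24 / (nsq n)\<^sup>2"
proof (cases "nsq n \<ge> 2")
  case False
  have m1: "nsq n = 1" using nsq_eq_1[OF assms] False by simp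
  have "lap_quot n \<le> 2 * (4 * a + 2)" using lap_quot_le_dim[OF assms] by (simp add: dim_eq)
  also have "\<dots> \<le> 24" using parameter_bounds by simp
  finally show ?thesis by (simp add: m1 A_eq add_increasing)
next
  case True
  define m where "m = nsq n"
  define q where "q = 1 / (nsq n + c + 1)"
  define y where "y j = 2 * of_int (n $ j) * q" for j
  let ?S = "\<Sum>j\<in>UNIV. (1 + y j) powr (- a) + (1 - y j) powr (- a)"
  note expan = lap_quot_expansion[OF True q_def y_def]
  have m: "m \<ge> 2" using True by (simp add: m_def)
  note pb = parameter_bounds
  define R where "R = m + c"
  define X where "X = a * (a + 1) * (4 * m * q\<^sup>2)"
  have R: "R \<ge> m" "R > 0" using m pb by (simp_all add: R_def)
  have q: "q = 1 / (R + 1)" by (simp add: q_def R_def m_def)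
  have "1 - a / R \<le> (1 - q) powr a"
  proof -
    have "1 - a / R \<le> 1 - a * ln (1 + 1 / R)"
      using mult_left_mono[OF ln_add_one_self_le_self[of "1 / R"], of a] R pb by simp
    also have "\<dots> \<le> exp (- a * ln (1 + 1 / R))" using exp_ge_add_one_self[of "- a * ln (1 + 1 / R)"] by simp
    also have "- a * ln (1 + 1 / R) = a * ln (1 - q)"
    proof -
      have "1 - q = inverse (1 + 1 / R)" using R by (simp add: q field_simps)
      thus ?thesis using R by (simp add: ln_inverse add_pos_pos)
    qed
    also have "exp (a * ln (1 - q)) = (1 - q) powr a" using R by (simp add: powr_def q)
    finally show ?thesis .
  qed
  moreover have "2 * CARD('d) + X \<le> ?S"
  proof -
    have "(\<Sum>j\<in>(UNIV::'d set). 2 + a * (a + 1) * (y j)\<^sup>2) \<le> ?S"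
      using pb expan(3) by (intro sum_mono even_part_lower) auto
    thus ?thesis unfolding sum.distrib sum_distrib_left[symmetric] expan(2) by (simp add: X_def m_def)
  qed
  moreover have aR: "a / R \<le> 1" using R m pb by simp
  moreover have X0: "X \<ge> 0" using pb m by (simp add: X_def)
  ultimately have "(1 - a / R) * (2 * CARD('d) + X) \<le> (1 - q) powr a * ?S"
    by (intro mult_mono) auto
  hence "lap_quot n \<le> 2 * CARD('d) - (1 - a / R) * (2 * CARD('d) + X)"
    unfolding expan(1) by simp
  also have "\<dots> = a / R * (2 * CARD('d)) + (a / R * X - X)" by (simp add: algebra_simps)
  also have "\<dots> \<le> a / m * (2 * CARD('d)) + (3 / (2 * m\<^sup>2) - X)"
  proof -
    have "q \<le> 1 / m" using R m by (simp add: q frac_le)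
    hence "q\<^sup>2 \<le> (1 / m)\<^sup>2" using R by (intro power_mono) (auto simp: q)
    hence "4 * m * q\<^sup>2 \<le> 4 * m * (1 / m)\<^sup>2" using m by (intro mult_left_mono) auto
    also have "\<dots> = 4 / m" using m by (simp add: power2_eq_square)
    finally have "X \<le> (1/2) * (1/2 + 1) * (4 / m)"
      unfolding X_def using pb m by (intro mult_mono) auto
    hence "X \<le> 3 / m" by simp
    moreover have "a / R \<le> (1/2) / m" using R m pb by (intro frac_le) auto
    ultimately have "a / R * X \<le> (1/2) / m * (3 / m)" using X0 m by (intro mult_mono) auto
    moreover have "a / R * (2 * CARD('d)) \<le> a / m * (2 * CARD('d))"
      using R m pb by (intro mult_right_mono divide_left_mono) auto
    ultimately show ?thesis by (simp add: power2_eq_square)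
  qed
  also have "\<dots> = A_const CARD('d) / m + 4 * a * (a + 1) * (1 / m - m / (m + (c + 1))\<^sup>2) + 3 / (2 * m\<^sup>2)"
    unfolding A_eq X_def q R_def using m
    by (simp add: dim_eq power_one_over power2_eq_square add.assoc field_simps)
  also have "4 * a * (a + 1) * (1 / m - m / (m + (c + 1))\<^sup>2) \<le> 3 * (25/4 / m\<^sup>2)"
  proof -
    have "1 / m - m / (m + (c + 1))\<^sup>2 \<le> 2 * (c + 1) / m\<^sup>2"
      using m pb by (intro inverse_square_shift_estimate) auto
    also have "\<dots> \<le> 25/4 / m\<^sup>2" using pb by (intro divide_right_mono) auto
    finally have 1: "1 / m - m / (m + (c + 1))\<^sup>2 \<le> 25/4 / m\<^sup>2" .
    have "4 * a * (a + 1) \<le> 4 * (1/2) * (1/2 + 1)" using pb by (intro mult_mono) auto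
    hence 2: "4 * a * (a + 1) \<le> 3" by simp
    have "4 * a * (a + 1) * (1 / m - m / (m + (c + 1))\<^sup>2) \<le> 4 * a * (a + 1) * (25/4 / m\<^sup>2)"
      using pb 1 by (intro mult_left_mono) auto
    also have "\<dots> \<le> 3 * (25/4 / m\<^sup>2)" using 2 by (intro mult_right_mono) auto
    finally show ?thesis .
  qed
  also have "A_const CARD('d) / m + 3 * (25/4 / m\<^sup>2) + 3 / (2 * m\<^sup>2) \<le> A_const CARD('d) / m + 24 / m\<^sup>2"
    using m by (simp add: field_simps)
  finally show ?thesis by (simp add: m_def)
qed

end

section \<open>Weighted masses and the ground state representation\<close>

lemma test_function_support:
  assumes "u \<in> test_functions"
  shows "finite {n. u n \<noteq> 0}" "finite {n. u (n + e) \<noteq> 0}"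
proof -
  show fin: "finite {n. u n \<noteq> 0}" using assms by (simp add: test_functions_def)
  have "{n. u (n + e) \<noteq> 0} = (\<lambda>n. n - e) ` {n. u n \<noteq> 0}"
    by (auto simp: image_iff intro: exI[of _ "_ + e"]) (metis add_diff_cancel)
  thus "finite {n. u (n + e) \<noteq> 0}" using fin by simp
qed

lemma summable_on_finite_support:
  fixes f :: "'a \<Rightarrow> 'b::{comm_monoid_add,topological_space}"
  assumes "finite S" "\<And>n. n \<notin> S \<Longrightarrow> f n = 0"
  shows "f summable_on A"
  by (rule finite_nonzero_values_imp_summable_on, rule finite_subset[OF _ assms(1)]) (use assms(2) in blast)

text \<open>
  Summability of any expression that lives on the edges in a fixed direction and vanishes on
  those where both end points carry the value zero.
\<close>
lemma summable_on_edges: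
  fixes f :: "int ^ 'd::finite \<Rightarrow> 'b::{comm_monoid_add,topological_space}"
  assumes "u \<in> test_functions" "\<And>n. u n = 0 \<Longrightarrow> u (n + e) = 0 \<Longrightarrow> f n = 0"
  shows "f summable_on A"
  by (rule summable_on_finite_support[where S = "{n. u n \<noteq> 0} \<union> {n. u (n + e) \<noteq> 0}"])
    (use assms test_function_support[OF assms(1)] in auto)

lemma infsum_sum_swap:
  fixes f :: "'j \<Rightarrow> 'a \<Rightarrow> real"
  assumes "finite J" "\<And>j. j \<in> J \<Longrightarrow> f j summable_on A"
  shows "infsum (\<lambda>n. \<Sum>j\<in>J. f j n) A = (\<Sum>j\<in>J. infsum (f j) A)"
proof (rule infsumI)
  show "((\<lambda>n. \<Sum>j\<in>J. f j n) has_sum (\<Sum>j\<in>J. infsum (f j) A)) A"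
    using assms by (induction J rule: finite_induct) (auto intro!: has_sum_add has_sum_infsum)
qed

lemma infsum_complex_of_real:
  "f summable_on A \<Longrightarrow> infsum (\<lambda>n. complex_of_real (f n)) A = of_real (infsum f A)"
  by (rule infsumI) (simp add: has_sum_of_real_iff)

lemma weighted_mass_summable:
  "u \<in> test_functions \<Longrightarrow> (\<lambda>n. W n * (cmod (u n))\<^sup>2) summable_on A"
  by (rule summable_on_finite_support[where S = "{n. u n \<noteq> 0}"]) (auto simp: test_functions_def)

lemma weighted_mass_mono:
  assumes "u \<in> test_functions" "\<And>n. n \<noteq> 0 \<Longrightarrow> V n \<le> W n"
  shows "weighted_mass V u \<le> weighted_mass W u"
  unfolding weighted_mass_def
  by (intro infsum_mono weighted_mass_summable assms mult_right_mono) (auto simp: punctured_lattice_def)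

lemma weighted_mass_add:
  assumes "u \<in> test_functions"
  shows "weighted_mass (\<lambda>n. V n + W n) u = weighted_mass V u + weighted_mass W u"
  unfolding weighted_mass_def distrib_right
  by (intro infsum_add weighted_mass_summable assms)

lemma weighted_mass_cmult:
  assumes "u \<in> test_functions"
  shows "weighted_mass (\<lambda>n. k * W n) u = k * weighted_mass W u"
  unfolding weighted_mass_def mult.assoc by (rule infsum_cmult_right') 

lemma weighted_mass_cong:
  "(\<And>n. n \<noteq> 0 \<Longrightarrow> V n = W n) \<Longrightarrow> weighted_mass V u = weighted_mass W u"
  unfolding weighted_mass_def by (intro infsum_cong) (auto simp: punctured_lattice_def)

lemma weighted_mass_nonneg:
  "(\<And>n. n \<noteq> 0 \<Longrightarrow> V n \<ge> 0) \<Longrightarrow> weighted_mass V u \<ge> 0"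
  unfolding weighted_mass_def by (intro infsum_nonneg) (auto simp: punctured_lattice_def)

lemma hardy_term_eq: "hardy_term u = weighted_mass (\<lambda>n. 1 / nsq n) u"
  unfolding hardy_term_def weighted_mass_def by simp

text \<open>
  The square of \<open>t - s\<close> completed in terms of the quotients \<open>s / p\<close> and \<open>t / q\<close>. Because
  \<open>x / 0 = 0\<close>, it also holds in the degenerate cases, so the edges that end at the origin need
  no separate treatment.
\<close>
lemma edge_identity:
  fixes s t :: complex and p q :: real
  assumes "p \<ge> 0" "q \<ge> 0" "p = 0 \<Longrightarrow> s = 0" "q = 0 \<Longrightarrow> t = 0"
  shows "(cmod (t - s))\<^sup>2 = (cmod s)\<^sup>2 * (1 - q / p) + (cmod t)\<^sup>2 * (1 - p / q)
     + p * q * (cmod (t / q - s / p))\<^sup>2"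
proof (cases "p = 0 \<or> q = 0")
  case True
  thus ?thesis using assms(3,4) by (auto simp: norm_minus_commute)
next
  case False
  hence "p > 0" "q > 0" using assms by auto
  thus ?thesis
    unfolding cmod_power2 minus_complex.sel Re_divide_of_real Im_divide_of_real
    by (simp add: field_simps power2_eq_square)
qed

text \<open>
  The energy of \<open>u / h\<close> with conductances \<open>h n h n'\<close> on the edges; the edges at the origin have
  conductance zero when \<open>h 0 = 0\<close>.
\<close>
definition ground_energy :: "(int ^ 'd::finite \<Rightarrow> real) \<Rightarrow> (int ^ 'd \<Rightarrow> complex) \<Rightarrow> real" where
  "ground_energy h u = (\<Sum>j\<in>UNIV. \<Sum>\<^sub>\<infinity>n\<in>UNIV. h n * h (n + unit_vec j) *
     (cmod (u (n + unit_vec j) / h (n + unit_vec j) - u n / h n))\<^sup>2)"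

lemma ground_energy_nonneg:
  assumes "\<And>n. h n \<ge> 0"
  shows "ground_energy h u \<ge> 0"
  unfolding ground_energy_def using assms by (intro sum_nonneg infsum_nonneg) auto

text \<open>
  Apply \<open>edge_identity\<close> to every edge and regroup by vertices: the edge from \<open>n\<close> to \<open>n + e\<^sub>j\<close>
  gives \<open>|u n|\<^sup>2 (1 - h (n + e\<^sub>j) / h n)\<close> to its first end point and the corresponding term to
  its second one, and the sum of what a vertex receives from its \<open>2 N\<close> edges is
  \<open>- \<Delta> h / h |u|\<^sup>2\<close>.
\<close>
lemma ground_state_identity:
  fixes h :: "int ^ 'd::finite \<Rightarrow> real"
  assumes h0: "h 0 = 0" and h: "\<And>n. n \<noteq> 0 \<Longrightarrow> h n > 0" and u: "u \<in> test_functions"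
  shows "energy u = weighted_mass (\<lambda>n. - discrete_laplacian h n / h n) u + ground_energy h u"
proof -
  have u0: "u 0 = 0" using u by (simp add: test_functions_def)
  have h_nonneg: "h n \<ge> 0" for n using h[of n] h0 by (cases "n = 0") auto
  have vanish: "u n = 0" if "h n = 0" for n using h[of n] u0 that by (cases "n = 0") auto
  define out where "out j n = (cmod (u n))\<^sup>2 * (1 - h (n + unit_vec j) / h n)" for j n
  define inc where "inc j n = (cmod (u n))\<^sup>2 * (1 - h (n - unit_vec j) / h n)" for j n
  define K where "K j n = h n * h (n + unit_vec j) *
     (cmod (u (n + unit_vec j) / h (n + unit_vec j) - u n / h n))\<^sup>2" for j n
  have S: "out j summable_on UNIV" "inc j summable_on UNIV" for j
    by (rule summable_on_finite_support[OF test_function_support(1)[OF u]], 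
        simp add: out_def inc_def)+
  have edge: "(\<Sum>\<^sub>\<infinity>n\<in>UNIV. (cmod (u (n + unit_vec j) - u n))\<^sup>2) =
     infsum (\<lambda>n. out j n + inc j n) UNIV + infsum (K j) UNIV" for j
  proof -
    have "(\<Sum>\<^sub>\<infinity>n\<in>UNIV. (cmod (u (n + unit_vec j) - u n))\<^sup>2) =
        (\<Sum>\<^sub>\<infinity>n\<in>UNIV. out j n + inc j (n + unit_vec j) + K j n)"
      unfolding out_def inc_def K_def
      by (intro infsum_cong, subst edge_identity[where p = "h _" and q = "h (_ + unit_vec j)"])
         (auto simp: h_nonneg vanish)
    also have "\<dots> = infsum (out j) UNIV + infsum (\<lambda>n. inc j (n + unit_vec j)) UNIV + infsum (K j) UNIV"
    proof -
      have "(\<lambda>n. inc j (n + unit_vec j)) summable_on UNIV" "K j summable_on UNIV"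
        by (rule summable_on_edges[OF u, of "unit_vec j"], simp add: inc_def K_def)+
      thus ?thesis using S[of j] by (simp add: infsum_add summable_on_add)
    qed
    also have "infsum (\<lambda>n. inc j (n + unit_vec j)) UNIV = infsum (inc j) UNIV"
      by (rule infsum_reindex_bij_betw) (rule bij_plus_right)
    finally show ?thesis using S[of j] by (simp add: infsum_add)
  qed
  have "energy u = (\<Sum>j\<in>UNIV. infsum (\<lambda>n. out j n + inc j n) UNIV) + ground_energy h u"
    unfolding energy_def edge ground_energy_def sum.distrib K_def ..
  also have "(\<Sum>j\<in>UNIV. infsum (\<lambda>n. out j n + inc j n) UNIV) =
      infsum (\<lambda>n. \<Sum>j\<in>UNIV. out j n + inc j n) UNIV"
    using S by (intro infsum_sum_swap[symmetric] summable_on_add) auto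
  also have "\<dots> = weighted_mass (\<lambda>n. - discrete_laplacian h n / h n) u"
    unfolding weighted_mass_def
  proof (rule infsum_cong_neutral)
    show "(\<Sum>j\<in>UNIV. out j n + inc j n) = - discrete_laplacian h n / h n * (cmod (u n))\<^sup>2"
      if "n \<in> UNIV \<inter> punctured_lattice" for n
    proof -
      have "h n > 0" using h that by (auto simp: punctured_lattice_def)
      hence eq: "out j n + inc j n =
         - (h (n + unit_vec j) + h (n - unit_vec j) - 2 * h n) / h n * (cmod (u n))\<^sup>2" for j
        by (simp add: out_def inc_def field_simps)
      show ?thesis
        unfolding eq discrete_laplacian_def sum_negf[symmetric] sum_divide_distrib sum_distrib_right ..
    qed
  qed (auto simp: out_def inc_def u0 punctured_lattice_def)
  finally show ?thesis .
qed

lemma infsum_linear: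
  fixes f g :: "'a \<Rightarrow> complex"
  assumes "f summable_on A" "g summable_on A"
  shows "infsum (\<lambda>n. x * f n + y * g n) A = x * infsum f A + y * infsum g A"
  using assms by (simp add: infsum_add summable_on_cmult_right infsum_cmult_right')

text \<open>
  The Hermitian form is obtained by polarising both sums; it is linear since all the sums over
  test functions converge.
\<close>
lemma quadratic_form_energy_minus_hardy:
  "quadratic_form (\<lambda>u :: int ^ 'd::finite \<Rightarrow> complex. energy u - k * hardy_term u)"
proof -
  let ?e = "unit_vec :: 'd \<Rightarrow> _"
  let ?X = "punctured_lattice :: (int ^ 'd) set"
  define G where "G j u w = (\<Sum>\<^sub>\<infinity>n\<in>UNIV. (u (n + ?e j) - u n) * cnj (w (n + ?e j) - w n))" for j u w
  define M where "M u w = (\<Sum>\<^sub>\<infinity>n\<in>?X. u n * cnj (w n) / of_real (nsq n))" for u w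
  define B where "B u w = (\<Sum>j\<in>UNIV. G j u w) - of_real k * M u w" for u w
  have SG: "(\<lambda>n. (u (n + ?e j) - u n) * cnj (w (n + ?e j) - w n)) summable_on UNIV"
    if "u \<in> test_functions" for j u w
    by (rule summable_on_edges[OF that, of "?e j"]) simp
  have SM: "(\<lambda>n. u n * cnj (w n) / of_real (nsq n)) summable_on ?X" if "u \<in> test_functions" for u w
    by (rule summable_on_finite_support[OF test_function_support(1)[OF that]]) simp
  have linear: "B (\<lambda>n. x * u n + y * v n) w = x * B u w + y * B v w"
    if u: "u \<in> test_functions" and v: "v \<in> test_functions" for u v w x y
  proof -
    have lin_G: "G j (\<lambda>n. x * u n + y * v n) w = x * G j u w + y * G j v w" for j
      unfolding G_def infsum_linear[OF SG[OF u] SG[OF v], symmetric]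
      by (intro infsum_cong) (simp add: algebra_simps)
    have lin_M: "M (\<lambda>n. x * u n + y * v n) w = x * M u w + y * M v w"
      unfolding M_def infsum_linear[OF SM[OF u] SM[OF v], symmetric]
      by (intro infsum_cong) (simp add: algebra_simps add_divide_distrib)
    show ?thesis
      unfolding B_def lin_G lin_M sum.distrib sum_distrib_left[symmetric] by (simp only: ring_distribs mult_ac) simp
  qed
  have hermitian: "B v u = cnj (B u v)" for u v
  proof -
    have "G j v u = cnj (G j u v)" for j
      unfolding G_def infsum_cnj[symmetric] by (intro infsum_cong) (simp only: complex_cnj_mult complex_cnj_cnj mult.commute)
    moreover have "M v u = cnj (M u v)"
      unfolding M_def infsum_cnj[symmetric]
      by (intro infsum_cong) (simp only: complex_cnj_mult complex_cnj_divide complex_cnj_cnj complex_cnj_complex_of_real mult.commute)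
    ultimately show ?thesis by (simp add: B_def)
  qed
  have diagonal: "of_real (energy u - k * hardy_term u) = B u u" if u: "u \<in> test_functions" for u
  proof -
    have "(\<lambda>n. (cmod (u (n + ?e j) - u n))\<^sup>2) summable_on UNIV" for j
      by (rule summable_on_edges[OF u, of "?e j"]) simp
    hence "of_real (\<Sum>\<^sub>\<infinity>n\<in>UNIV. (cmod (u (n + ?e j) - u n))\<^sup>2) = G j u u" for j
      unfolding G_def by (simp only: infsum_complex_of_real[symmetric] complex_norm_square)
    moreover have "(\<lambda>n. (cmod (u n))\<^sup>2 / nsq n) summable_on ?X"
      by (rule summable_on_finite_support[OF test_function_support(1)[OF u]]) simp
    hence "of_real (hardy_term u) = M u u"
      unfolding M_def hardy_term_def
      by (simp only: infsum_complex_of_real[symmetric] complex_norm_square of_real_divide)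
    ultimately show ?thesis by (simp add: B_def energy_def)
  qed
  show ?thesis unfolding quadratic_form_def
    by (intro exI[of _ B] conjI ballI allI linear hermitian diagonal)
qed

section \<open>Shells of the sup norm\<close>

definition sup_norm :: "int ^ 'd::finite \<Rightarrow> nat" where
  "sup_norm n = Max (range (\<lambda>i. nat \<bar>n $ i\<bar>))"

lemma sup_norm_le_iff: "sup_norm n \<le> k \<longleftrightarrow> (\<forall>i. \<bar>n $ i\<bar> \<le> int k)"
  unfolding sup_norm_def by (subst Max_le_iff) (auto simp: nat_le_iff)

lemma coord_le_sup_norm: "\<bar>n $ i\<bar> \<le> int (sup_norm n)"
  using sup_norm_le_iff[of n "sup_norm n"] by simp

lemma sup_norm_attained: obtains i where "\<bar>n $ i\<bar> = int (sup_norm n)"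
proof -
  have "sup_norm n \<in> range (\<lambda>i. nat \<bar>n $ i\<bar>)"
    unfolding sup_norm_def by (rule Max_in) auto
  then obtain i where "sup_norm n = nat \<bar>n $ i\<bar>" by blast
  thus ?thesis using that[of i] by simp
qed

lemma sup_norm_eq_0_iff: "sup_norm n = 0 \<longleftrightarrow> n = 0"
  using sup_norm_le_iff[of n 0] by (auto simp: vec_eq_iff)

lemma sup_norm_ge_1: "n \<noteq> 0 \<Longrightarrow> 1 \<le> sup_norm n"
  using sup_norm_eq_0_iff[of n] by linarith

lemma sup_norm_add_unit_vec: "sup_norm (n + unit_vec j) \<le> sup_norm n + 1"
  unfolding sup_norm_le_iff
proof
  show "\<bar>(n + unit_vec j) $ i\<bar> \<le> int (sup_norm n + 1)" for i
    using coord_le_sup_norm[of n i] by (auto simp: unit_vec_def axis_def)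
qed

lemma sup_norm_le_add_unit_vec: "sup_norm n \<le> sup_norm (n + unit_vec j) + 1"
  unfolding sup_norm_le_iff
proof
  show "\<bar>n $ i\<bar> \<le> int (sup_norm (n + unit_vec j) + 1)" for i
    using coord_le_sup_norm[of "n + unit_vec j" i] by (auto simp: unit_vec_def axis_def split: if_splits)
qed

lemma sup_norm_sq_le_nsq: "(real (sup_norm n))\<^sup>2 \<le> nsq n"
proof -
  obtain i where i: "\<bar>n $ i\<bar> = int (sup_norm n)" by (rule sup_norm_attained)
  have "(real (sup_norm n))\<^sup>2 = (of_int \<bar>n $ i\<bar>)\<^sup>2" by (simp only: i of_int_of_nat_eq)
  also have "\<dots> = (of_int (n $ i))\<^sup>2" by simp
  also have "\<dots> \<le> nsq n" by (rule coord_sq_le_nsq)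
  finally show ?thesis .
qed

lemma nsq_le_sup_norm_sq:
  fixes n :: "int ^ 'd::finite"
  shows "nsq n \<le> CARD('d) * (real (sup_norm n))\<^sup>2"
proof -
  have "(n $ i)\<^sup>2 \<le> (int (sup_norm n))\<^sup>2" for i
    using coord_le_sup_norm[of n i] abs_le_square_iff[of "n $ i" "int (sup_norm n)"] by simp
  hence "(\<Sum>i\<in>UNIV. (n $ i)\<^sup>2) \<le> (\<Sum>i\<in>(UNIV::'d set). (int (sup_norm n))\<^sup>2)" by (intro sum_mono) auto
  hence "nsq n \<le> real_of_int (\<Sum>i\<in>(UNIV::'d set). (int (sup_norm n))\<^sup>2)"
    unfolding nsq_sum of_int_le_iff .
  thus ?thesis by simp
qed

text \<open>
  The sup norm is preferred to the Euclidean norm for the cutoffs because its balls are cubes,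
  whose points are counted exactly.
\<close>
lemma box_card:
  fixes k :: nat
  shows "finite {n :: int ^ 'd::finite. sup_norm n \<le> k}"
    and "card {n :: int ^ 'd::finite. sup_norm n \<le> k} = (2 * k + 1) ^ CARD('d)"
proof -
  let ?P = "\<Pi>\<^sub>E i\<in>(UNIV::'d set). {- int k..int k}"
  have eq: "{n :: int ^ 'd. sup_norm n \<le> k} = vec_lambda ` ?P"
  proof (intro set_eqI iffI)
    fix n :: "int ^ 'd" assume "n \<in> {n. sup_norm n \<le> k}"
    hence bound: "\<bar>n $ i\<bar> \<le> int k" for i by (simp add: sup_norm_le_iff)
    have "n $ i \<in> {- int k..int k}" for i
      using bound[of i] unfolding atLeastAtMost_iff by linarith
    hence "vec_nth n \<in> ?P" by auto
    thus "n \<in> vec_lambda ` ?P" by (metis image_eqI vec_nth_inverse)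
  next
    fix n assume "n \<in> vec_lambda ` ?P"
    then obtain f where f: "n = vec_lambda f" "f \<in> ?P" by blast
    have "\<bar>f i\<bar> \<le> int k" for i
      using PiE_mem[OF f(2), of i] by (simp add: abs_le_iff)
    thus "n \<in> {n. sup_norm n \<le> k}" by (simp add: f(1) sup_norm_le_iff)
  qed
  show "finite {n :: int ^ 'd. sup_norm n \<le> k}"
    unfolding eq by (intro finite_imageI finite_PiE) auto
  have "inj_on (vec_lambda :: ('d \<Rightarrow> int) \<Rightarrow> _) ?P"
    by (rule inj_on_subset[of _ UNIV]) (auto intro: injI simp: vec_lambda_inject)
  thus "card {n :: int ^ 'd. sup_norm n \<le> k} = (2 * k + 1) ^ CARD('d)"
    unfolding eq by (simp add: card_image card_PiE nat_add_distrib nat_mult_distrib)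
qed

text \<open>
  The shell is the difference of two cubes: it has \<open>24 k\<^sup>2 + 2\<close> points for \<open>N = 3\<close> and
  \<open>64 k\<^sup>3 + 16 k\<close> points for \<open>N = 4\<close>.
\<close>
lemma shell_card:
  fixes k :: nat
  assumes "CARD('d::finite) = 3 \<or> CARD('d) = 4" "k \<ge> 1"
  shows "real k ^ (CARD('d) - 1) \<le> card {n :: int ^ 'd. sup_norm n = k}"
    and "card {n :: int ^ 'd. sup_norm n = k} \<le> 80 * real k ^ (CARD('d) - 1)"
proof -
  have shell: "{n :: int ^ 'd. sup_norm n = k} = {n. sup_norm n \<le> k} - {n. sup_norm n \<le> k - 1}"
    using assms(2) by auto
  have "card {n :: int ^ 'd. sup_norm n = k} =
      card {n :: int ^ 'd. sup_norm n \<le> k} - card {n :: int ^ 'd. sup_norm n \<le> k - 1}"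
    unfolding shell by (rule card_Diff_subset) (auto intro: box_card(1))
  hence "card {n :: int ^ 'd. sup_norm n = k} = (2 * k + 1) ^ CARD('d) - (2 * (k - 1) + 1) ^ CARD('d)"
    unfolding box_card .
  moreover have "(2 * (k - 1) + 1) ^ CARD('d) \<le> (2 * k + 1) ^ CARD('d)" by (intro power_mono) auto
  ultimately have c: "real (card {n :: int ^ 'd. sup_norm n = k})
      = (2 * real k + 1) ^ CARD('d) - (2 * real k - 1) ^ CARD('d)"
    using assms(2) by (simp add: of_nat_diff add.commute)
  have k: "real k \<ge> 1" using assms(2) by simp
  have k2: "1 \<le> (real k)\<^sup>2" using k by simp
  from assms(1) have "real k ^ (CARD('d) - 1) \<le> card {n :: int ^ 'd. sup_norm n = k} \<and>
      card {n :: int ^ 'd. sup_norm n = k} \<le> 80 * real k ^ (CARD('d) - 1)"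
  proof
    assume N: "CARD('d) = 3"
    have "(2 * real k + 1) ^ 3 - (2 * real k - 1) ^ 3 = 24 * (real k)\<^sup>2 + 2" by algebra
    thus ?thesis unfolding c N using k2 by simp
  next
    assume N: "CARD('d) = 4"
    have "(2 * real k + 1) ^ 4 - (2 * real k - 1) ^ 4 = 64 * real k ^ 3 + 16 * real k" by algebra
    moreover have "real k \<le> real k ^ 3" using mult_left_mono[OF k2, of "real k"]
      by (simp add: power3_eq_cube power2_eq_square)
    ultimately show ?thesis unfolding c N using k by simp
  qed
  thus "real k ^ (CARD('d) - 1) \<le> card {n :: int ^ 'd. sup_norm n = k}"
    and "card {n :: int ^ 'd. sup_norm n = k} \<le> 80 * real k ^ (CARD('d) - 1)" by auto
qed

text \<open>
  The critical lattice sum: summed shell by shell, it is comparable to the harmonic series. The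
  upper bound controls the energy of the cutoffs, the lower bound makes their Hardy terms
  unbounded.
\<close>
lemma sum_inverse_power_sup_norm:
  fixes M :: nat
  assumes "CARD('d::finite) = 3 \<or> CARD('d) = 4"
  defines "S \<equiv> {n :: int ^ 'd. 1 \<le> sup_norm n \<and> sup_norm n \<le> M}"
  shows "finite S"
    and "harm M \<le> (\<Sum>n\<in>S. 1 / real (sup_norm n) ^ CARD('d))"
    and "(\<Sum>n\<in>S. 1 / real (sup_norm n) ^ CARD('d)) \<le> 80 * harm M"
proof -
  show fin: "finite S" unfolding S_def by (rule finite_subset[OF _ box_card(1)[of M]]) auto
  let ?shell = "\<lambda>k. {n :: int ^ 'd. sup_norm n = k}"
  have "(\<Sum>n\<in>S. 1 / real (sup_norm n) ^ CARD('d)) =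
      (\<Sum>k = 1..M. \<Sum>n\<in>{n\<in>S. sup_norm n = k}. 1 / real (sup_norm n) ^ CARD('d))"
    by (rule sum.group[symmetric]) (use fin in \<open>auto simp: S_def\<close>)
  also have "\<dots> = (\<Sum>k = 1..M. card (?shell k) / real k ^ CARD('d))"
  proof (intro sum.cong refl)
    fix k assume "k \<in> {1..M}"
    hence "{n\<in>S. sup_norm n = k} = ?shell k" by (auto simp: S_def)
    thus "(\<Sum>n\<in>{n\<in>S. sup_norm n = k}. 1 / real (sup_norm n) ^ CARD('d)) = card (?shell k) / real k ^ CARD('d)"
      by simp
  qed
  finally have eq: "(\<Sum>n\<in>S. 1 / real (sup_norm n) ^ CARD('d)) = (\<Sum>k = 1..M. card (?shell k) / real k ^ CARD('d))" .
  have pw: "real k ^ (CARD('d) - 1) / real k ^ CARD('d) = inverse (real k)" if "k \<ge> 1" for k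
  proof -
    have "real k ^ CARD('d) = real k * real k ^ (CARD('d) - 1)"
      by (rule power_eq_if[THEN trans]) simp
    thus ?thesis using that by (simp add: field_simps)
  qed
  show "harm M \<le> (\<Sum>n\<in>S. 1 / real (sup_norm n) ^ CARD('d))"
    unfolding eq harm_def
  proof (rule sum_mono)
    fix k assume k: "k \<in> {1..M}"
    have "inverse (real k) = real k ^ (CARD('d) - 1) / real k ^ CARD('d)" using k pw[of k] by simp
    also have "\<dots> \<le> card (?shell k) / real k ^ CARD('d)"
      using k shell_card(1)[OF assms(1), of k] by (intro divide_right_mono) auto
    finally show "inverse (real k) \<le> card (?shell k) / real k ^ CARD('d)" .
  qed
  show "(\<Sum>n\<in>S. 1 / real (sup_norm n) ^ CARD('d)) \<le> 80 * harm M"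
    unfolding eq harm_def sum_distrib_left
  proof (rule sum_mono)
    fix k assume k: "k \<in> {1..M}"
    have "card (?shell k) / real k ^ CARD('d) \<le> 80 * real k ^ (CARD('d) - 1) / real k ^ CARD('d)"
      using k shell_card(2)[OF assms(1), of k] by (intro divide_right_mono) auto
    also have "\<dots> = 80 * inverse (real k)" using pw[of k] k by (simp flip: times_divide_eq_right)
    finally show "card (?shell k) / real k ^ CARD('d) \<le> 80 * inverse (real k)" .
  qed
qed

section \<open>Almost extremal functions\<close>

text \<open>
  A logarithmic cutoff with harmonic numbers instead of logarithms: its increments are exactly
  the terms \<open>1 / k\<close> of the harmonic series divided by \<open>harm M\<close>, up to the truncation at 0.
\<close>
definition harm_cutoff :: "nat \<Rightarrow> nat \<Rightarrow> real" where
  "harm_cutoff M k = max 0 (1 - harm k / harm M)"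

lemma harm_cutoff_range: "0 \<le> harm_cutoff M k" "harm_cutoff M k \<le> 1"
  using harm_nonneg[of M, where ?'a = real] harm_nonneg[of k, where ?'a = real] by (auto simp: harm_cutoff_def)

lemma harm_cutoff_eq_0: "M \<ge> 1 \<Longrightarrow> k \<ge> M \<Longrightarrow> harm_cutoff M k = 0"
  using harm_mono[of M k, where ?'a = real] harm_pos[of M, where ?'a = real] 
  by (simp add: harm_cutoff_def le_divide_eq_1)

lemma harm_cutoff_diff:
  assumes M: "M \<ge> 1" and k: "k \<ge> 1" "l \<ge> 1" "l \<le> k + 1" "k \<le> l + 1"
  shows "\<bar>harm_cutoff M l - harm_cutoff M k\<bar> \<le> 1 / (k * harm M)"
proof -
  have H: "harm M > (0::real)" using M by (intro harm_pos) auto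
  have "\<bar>harm l - harm k\<bar> \<le> 1 / real k"
  proof -
    consider "l = k" | "l = Suc k" | "k = Suc l" using k by linarith
    thus ?thesis
    proof cases
      case 2
      have "1 / (1 + real k) \<le> 1 / real k" using k by (intro divide_left_mono) auto
      thus ?thesis by (simp add: 2 harm_Suc inverse_eq_divide)
    qed (simp_all add: harm_Suc inverse_eq_divide)
  qed
  hence "\<bar>harm l - harm k\<bar> / harm M \<le> 1 / real k / harm M"
    by (rule divide_right_mono) (rule less_imp_le[OF H])
  moreover have "\<bar>harm_cutoff M l - harm_cutoff M k\<bar> \<le> \<bar>harm l / harm M - harm k / harm M\<bar>"
    unfolding harm_cutoff_def by linarith
  moreover have "\<bar>harm l / harm M - harm k / harm M\<bar> = \<bar>harm l - harm k\<bar> / (harm M :: real)"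
    by (simp only: diff_divide_distrib[symmetric] abs_divide abs_of_pos[OF H])
  ultimately show ?thesis by simp
qed

context hardy_profile
begin

lemma dim_cases: "CARD('d) = 3 \<or> CARD('d) = 4"
  using parameters by auto

lemma power_dim: "x ^ (CARD('d) - 2) * x\<^sup>2 = (x :: real) ^ CARD('d)"
proof -
  have "CARD('d) - 2 + 2 = CARD('d)" using dim_cases by auto
  thus ?thesis by (simp only: power_add[symmetric])
qed

text \<open>
  Because \<open>4 a = N - 2\<close>, a product of two values of the profile at distance about \<open>x\<close> is of the
  size of the integer power \<open>x ^ - (N - 2)\<close>.
\<close>
lemma powr_dim:
  assumes "x > 0"
  shows "(x\<^sup>2) powr (- a) * (x\<^sup>2) powr (- a) = 1 / x ^ (CARD('d) - 2)"
proof -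
  have "(x\<^sup>2) powr (- a) * (x\<^sup>2) powr (- a) = (x\<^sup>2) powr (- (2 * a))"
    by (simp flip: powr_add)
  also have "\<dots> = x powr (- (4 * a))"
  proof -
    have "x\<^sup>2 = x powr 2" using assms by simp
    thus ?thesis by (simp only: powr_powr) simp
  qed
  also have "4 * a = real (CARD('d) - 2)" using parameters by auto
  also have "x powr (- real (CARD('d) - 2)) = 1 / x ^ (CARD('d) - 2)"
    using assms by (simp add: powr_minus powr_realpow inverse_eq_divide)
  finally show ?thesis .
qed

lemma h_le_1: "h n \<le> 1"
proof (cases "n = 0")
  case False
  have "(nsq n + c) powr (- a) \<le> 1 powr (- a)"
    using nsq_ge_1[OF False] parameter_bounds by (intro powr_mono2') auto
  thus ?thesis by (simp add: profile False)
qed (simp add: h_0)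

text \<open>
  The sup norms of neighbours off the origin differ by at most 1 and hence by at most a factor
  2, so the hypothesis covers all edges that carry ground energy.
\<close>
lemma h_product_upper:
  assumes "n \<noteq> 0" "n' \<noteq> 0" "sup_norm n \<le> 2 * sup_norm n'"
  shows "h n * h n' \<le> 2 / real (sup_norm n) ^ (CARD('d) - 2)"
proof -
  define k where "k = real (sup_norm n)"
  have k: "k > 0" using sup_norm_ge_1[OF assms(1)] by (simp add: k_def)
  have "k \<le> 2 * real (sup_norm n')" using assms(3) by (simp add: k_def)
  hence "(k / 2)\<^sup>2 \<le> (real (sup_norm n'))\<^sup>2" using k by (intro power_mono) auto
  hence n': "k\<^sup>2 / 4 \<le> nsq n'" using sup_norm_sq_le_nsq[of n'] by (simp add: power_divide)
  have "h n \<le> (k\<^sup>2) powr (- a)"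
    unfolding profile k_def using assms(1) sup_norm_sq_le_nsq[of n] parameter_bounds k
    by (auto intro!: powr_mono2' simp: k_def)
  moreover have "h n' \<le> 2 * (k\<^sup>2) powr (- a)"
  proof -
    have "h n' \<le> (k\<^sup>2 / 4) powr (- a)"
      unfolding profile using assms(2) n' parameter_bounds k by (auto intro!: powr_mono2')
    also have "\<dots> = 4 powr a * (k\<^sup>2) powr (- a)"
      using k by (simp add: powr_divide powr_minus field_simps)
    also have "4 powr a \<le> 4 powr (1/2)" using parameter_bounds by (intro powr_mono) auto
    also have "(4::real) powr (1/2) = 2" by (simp add: powr_half_sqrt)
    finally show ?thesis by (simp add: mult_right_mono)
  qed
  ultimately have "h n * h n' \<le> (k\<^sup>2) powr (- a) * (2 * (k\<^sup>2) powr (- a))"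
    using h_nonneg by (intro mult_mono) auto
  also have "\<dots> = 2 / k ^ (CARD('d) - 2)" using powr_dim[OF k] by simp
  finally show ?thesis by (simp add: k_def)
qed

lemma h_square_lower:
  assumes "n \<noteq> 0"
  shows "1 / (7 * real (sup_norm n) ^ (CARD('d) - 2)) \<le> (h n)\<^sup>2"
proof -
  define k where "k = real (sup_norm n)"
  have k: "k \<ge> 1" using sup_norm_ge_1[OF assms] by (simp add: k_def)
  have k2: "k\<^sup>2 \<ge> 1" using k by simp
  have "nsq n \<le> CARD('d) * k\<^sup>2" unfolding k_def by (rule nsq_le_sup_norm_sq)
  also have "\<dots> \<le> 4 * k\<^sup>2" using dim_cases by (intro mult_right_mono) auto
  finally have "nsq n + c \<le> 7 * k\<^sup>2" using k2 parameter_bounds by simp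
  hence "(7 * k\<^sup>2) powr (- a) \<le> h n"
    unfolding profile using assms base_pos[of n] parameter_bounds by (auto intro!: powr_mono2')
  hence "((7 * k\<^sup>2) powr (- a))\<^sup>2 \<le> (h n)\<^sup>2" by (intro power_mono) auto
  moreover have "((7 * k\<^sup>2) powr (- a))\<^sup>2 = 7 powr (- 2 * a) * (1 / k ^ (CARD('d) - 2))"
  proof -
    have "((7 * k\<^sup>2) powr (- a))\<^sup>2 = (7 powr (- a) * 7 powr (- a)) * ((k\<^sup>2) powr (- a) * (k\<^sup>2) powr (- a))"
      by (simp add: powr_mult power2_eq_square[of "_ * _"])
    also have "7 powr (- a) * 7 powr (- a) = (7 :: real) powr (- 2 * a)" by (simp flip: powr_add)
    finally show ?thesis using powr_dim[of k] k by simp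
  qed
  moreover have "7 powr (- 1) * (1 / k ^ (CARD('d) - 2)) \<le> 7 powr (- 2 * a) * (1 / k ^ (CARD('d) - 2))"
    using parameter_bounds k by (intro mult_right_mono powr_mono) auto
  ultimately show ?thesis by (simp add: k_def powr_minus)
qed

definition cutoff_profile :: "nat \<Rightarrow> int ^ 'd \<Rightarrow> complex" where
  "cutoff_profile M n = of_real (h n * harm_cutoff M (sup_norm n))"

lemma cutoff_profile_test_function:
  assumes "M \<ge> 1"
  shows "cutoff_profile M \<in> test_functions"
proof -
  have "{n. cutoff_profile M n \<noteq> 0} \<subseteq> {n. sup_norm n \<le> M}"
  proof (rule Collect_mono, rule impI, rule ccontr)
    fix n assume "cutoff_profile M n \<noteq> 0" "\<not> sup_norm n \<le> M"
    thus False using harm_cutoff_eq_0[OF assms, of "sup_norm n"] by (simp add: cutoff_profile_def)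
  qed
  hence "finite {n. cutoff_profile M n \<noteq> 0}" by (rule finite_subset[OF _ box_card(1)])
  thus ?thesis by (simp add: test_functions_def cutoff_profile_def h_0)
qed

lemma cmod_cutoff_profile: "cmod (cutoff_profile M n) = h n * harm_cutoff M (sup_norm n)"
  unfolding cutoff_profile_def norm_of_real by (simp add: h_nonneg harm_cutoff_range)

text \<open>
  On an edge at sup norm \<open>k\<close> the conductance is at most \<open>2 / k ^ (N - 2)\<close> and the cutoff changes
  by at most \<open>1 / (k harm M)\<close>. The sum over one direction is thus at most
  \<open>160 harm M / (harm M)\<^sup>2\<close>; boundedness independently of \<open>M\<close> is all that matters.
\<close>
lemma ground_energy_cutoff_profile:
  assumes M: "M \<ge> 1"
  shows "ground_energy h (cutoff_profile M) \<le> 640"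
proof -
  let ?u = "cutoff_profile M"
  let ?S = "{n :: int ^ 'd. 1 \<le> sup_norm n \<and> sup_norm n \<le> M}"
  have H: "harm M \<ge> (1::real)" using harm_mono[OF M, where ?'a = real] by (simp add: harm_expand)
  have "(\<Sum>\<^sub>\<infinity>n\<in>UNIV. h n * h (n + unit_vec j) *
      (cmod (?u (n + unit_vec j) / h (n + unit_vec j) - ?u n / h n))\<^sup>2) \<le> 160" for j
  proof -
    define f where "f = (\<lambda>n. h n * h (n + unit_vec j) *
      (cmod (?u (n + unit_vec j) / h (n + unit_vec j) - ?u n / h n))\<^sup>2)"
    have f: "f n = h n * h (n + unit_vec j) *
       (harm_cutoff M (sup_norm (n + unit_vec j)) - harm_cutoff M (sup_norm n))\<^sup>2"
      if "n \<noteq> 0" "n + unit_vec j \<noteq> 0" for n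
    proof -
      have "?u (n + unit_vec j) / h (n + unit_vec j) - ?u n / h n
        = of_real (harm_cutoff M (sup_norm (n + unit_vec j)) - harm_cutoff M (sup_norm n))"
        using h_pos[OF that(1)] h_pos[OF that(2)] by (simp add: cutoff_profile_def)
      thus ?thesis unfolding f_def by (simp only: norm_of_real power2_abs)
    qed
    have f0: "f n = 0" if "n = 0 \<or> n + unit_vec j = 0" for n
      using that by (auto simp: f_def h_0)
    have "infsum f UNIV = infsum f ?S"
    proof (rule infsum_cong_neutral)
      fix n assume n: "n \<in> UNIV - ?S"
      show "f n = 0"
      proof (cases "n = 0 \<or> n + unit_vec j = 0")
        case False
        hence "sup_norm n > M" using n sup_norm_ge_1[of n] by auto
        moreover from this have "sup_norm (n + unit_vec j) \<ge> M"
          using sup_norm_le_add_unit_vec[of n j] by linarith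
        ultimately show ?thesis using False harm_cutoff_eq_0[OF M] by (simp add: f)
      qed (rule f0)
    qed auto
    also have "\<dots> = sum f ?S"
      using sum_inverse_power_sup_norm(1)[OF dim_cases] by (rule infsum_finite)
    also have "\<dots> \<le> (\<Sum>n\<in>?S. 2 / (harm M)\<^sup>2 * (1 / real (sup_norm n) ^ CARD('d)))"
    proof (rule sum_mono)
      fix n assume n: "n \<in> ?S"
      define k where "k = sup_norm n"
      have k: "k \<ge> 1" "n \<noteq> 0" using n sup_norm_eq_0_iff[of n] by (auto simp: k_def)
      show "f n \<le> 2 / (harm M)\<^sup>2 * (1 / real (sup_norm n) ^ CARD('d))"
      proof (cases "n + unit_vec j = 0")
        case False
        define l where "l = sup_norm (n + unit_vec j)"
        have "l \<noteq> 0" using False by (simp add: l_def sup_norm_eq_0_iff)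
        hence l: "l \<ge> 1" "l \<le> k + 1" "k \<le> l + 1"
          using sup_norm_add_unit_vec[of n j] sup_norm_le_add_unit_vec[of n j] by (auto simp: k_def l_def)
        have hh: "h n * h (n + unit_vec j) \<le> 2 / real k ^ (CARD('d) - 2)"
          unfolding k_def using k False l by (intro h_product_upper) (auto simp: k_def l_def)
        have "\<bar>harm_cutoff M l - harm_cutoff M k\<bar>\<^sup>2 \<le> (1 / (k * harm M))\<^sup>2"
          by (intro power_mono harm_cutoff_diff) (use M k l in auto)
        hence "f n \<le> 2 / real k ^ (CARD('d) - 2) * (1 / (k * harm M))\<^sup>2"
          unfolding f[OF k(2) False] using hh
          by (intro mult_mono) (auto simp: k_def l_def)
        also have "\<dots> = 2 / (harm M)\<^sup>2 * (1 / (real k ^ (CARD('d) - 2) * (real k)\<^sup>2))"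
          by (simp add: power_divide power_mult_distrib)
        also have "real k ^ (CARD('d) - 2) * (real k)\<^sup>2 = real k ^ CARD('d)"
          by (rule power_dim)
        finally show ?thesis by (simp add: k_def)
      qed (simp add: f0)
    qed
    also have "\<dots> \<le> 2 / (harm M)\<^sup>2 * (80 * harm M)"
      unfolding sum_distrib_left[symmetric]
      by (intro mult_left_mono sum_inverse_power_sup_norm(3)[OF dim_cases]) auto
    also have "\<dots> = 160 / harm M" using H by (simp add: power2_eq_square)
    also have "\<dots> \<le> 160" using divide_left_mono[OF H, of 160] M by simp
    finally show ?thesis by (simp add: f_def)
  qed
  hence "ground_energy h ?u \<le> (\<Sum>j\<in>(UNIV :: 'd set). 160)"
    unfolding ground_energy_def by (intro sum_mono)
  also have "\<dots> \<le> 640" using dim_cases by auto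
  finally show ?thesis .
qed

text \<open>
  Where \<open>harm k\<close> is at most half of \<open>harm M\<close>, the cutoff is at least \<open>1/2\<close>. There the summand of
  the Hardy term is at least \<open>1 / (112 k ^ N)\<close>, with \<open>112 = 4 * 4 * 7\<close> collecting the squared
  cutoff, \<open>|n|\<^sup>2 \<le> 4 k\<^sup>2\<close> and the lower bound for \<open>h\<^sup>2\<close>.
\<close>
lemma hardy_term_cutoff_profile:
  assumes M: "M \<ge> 1" and K: "harm K \<le> (harm M :: real) / 2"
  shows "harm K / 112 \<le> hardy_term (cutoff_profile M)"
proof -
  let ?S = "{n :: int ^ 'd. 1 \<le> sup_norm n \<and> sup_norm n \<le> K}"
  have H: "harm M > (0::real)" using M by (intro harm_pos) auto
  have "harm K / 112 \<le> (\<Sum>n\<in>?S. 1 / real (sup_norm n) ^ CARD('d)) / 112"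
    using sum_inverse_power_sup_norm(2)[OF dim_cases, of K] by simp
  also have "\<dots> \<le> (\<Sum>n\<in>?S. 1 / nsq n * (cmod (cutoff_profile M n))\<^sup>2)"
    unfolding sum_divide_distrib
  proof (rule sum_mono)
    fix n assume n: "n \<in> ?S"
    define k where "k = real (sup_norm n)"
    have n0: "n \<noteq> 0" using n sup_norm_eq_0_iff[of n] by auto
    have k: "k \<ge> 1" using n by (simp add: k_def)
    have "harm (sup_norm n) \<le> (harm K :: real)" using n by (intro harm_mono) auto
    hence "harm (sup_norm n) / harm M \<le> (1 / 2 :: real)" using K H by (simp add: divide_le_eq)
    hence "1 / 2 \<le> harm_cutoff M (sup_norm n)" unfolding harm_cutoff_def by linarith
    hence psi: "1 / 4 \<le> (harm_cutoff M (sup_norm n))\<^sup>2"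
      using power_mono[of "1 / 2" "harm_cutoff M (sup_norm n)" 2] by (simp add: power2_eq_square)
    have "nsq n \<le> CARD('d) * k\<^sup>2" unfolding k_def by (rule nsq_le_sup_norm_sq)
    also have "\<dots> \<le> 4 * k\<^sup>2" using dim_cases by (intro mult_right_mono) auto
    finally have m: "1 / (4 * k\<^sup>2) \<le> 1 / nsq n" using nsq_ge_1[OF n0] by (intro frac_le) auto
    have "k ^ CARD('d) = k ^ (CARD('d) - 2) * k\<^sup>2"
      by (rule power_dim[symmetric])
    hence "1 / k ^ CARD('d) / 112 = 1 / (4 * k\<^sup>2) * (1 / (7 * k ^ (CARD('d) - 2)) * (1 / 4))"
      by simp
    also have "\<dots> \<le> 1 / nsq n * ((h n)\<^sup>2 * (harm_cutoff M (sup_norm n))\<^sup>2)"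
      using m psi k h_square_lower[OF n0] by (intro mult_mono) (auto simp: k_def)
    finally show "1 / real (sup_norm n) ^ CARD('d) / 112 \<le> 1 / nsq n * (cmod (cutoff_profile M n))\<^sup>2"
      by (simp add: cmod_cutoff_profile power_mult_distrib k_def)
  qed
  also have "\<dots> \<le> hardy_term (cutoff_profile M)"
    unfolding hardy_term_eq weighted_mass_def
    by (rule finite_sum_le_infsum[OF weighted_mass_summable[OF cutoff_profile_test_function[OF M]]])
      (use sum_inverse_power_sup_norm(1)[OF dim_cases] in \<open>auto simp: punctured_lattice_def sup_norm_eq_0_iff[THEN iffD2]\<close>)
  finally show ?thesis .
qed

lemma finite_nsq_less: "finite {n :: int ^ 'd. nsq n < r}"
proof (rule finite_subset[OF _ box_card(1)[of "nat \<lceil>r\<rceil>"]])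
  have "sup_norm n \<le> nat \<lceil>r\<rceil>" if "nsq n < r" for n :: "int ^ 'd"
  proof -
    have "real (sup_norm n) \<le> (real (sup_norm n))\<^sup>2" by (cases "sup_norm n = 0") (auto intro: self_le_power)
    hence "real (sup_norm n) < r" using sup_norm_sq_le_nsq[of n] that by linarith
    thus ?thesis by linarith
  qed
  thus "{n :: int ^ 'd. nsq n < r} \<subseteq> {n. sup_norm n \<le> nat \<lceil>r\<rceil>}" by auto
qed

text \<open>
  By \<open>lap_quot_upper\<close> the generated weight is at most \<open>(A + \<delta>) / |n|\<^sup>2\<close> outside a finite set
  \<open>F\<close>. On \<open>F\<close>, and in the ground energy, the functions \<open>cutoff_profile M\<close> cost at most a
  constant \<open>C\<close> independent of \<open>M\<close>, while their Hardy terms are unbounded; so \<open>C\<close> is eventually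
  at most \<open>\<delta>\<close> times the Hardy term.
\<close>
lemma almost_extremal:
  assumes eps: "\<epsilon> > 0"
  shows "\<exists>u. u \<in> test_functions \<and> 0 < hardy_term (u :: int ^ 'd \<Rightarrow> complex) \<and>
    energy u \<le> (A_const CARD('d) + \<epsilon>) * hardy_term u"
proof -
  define \<delta> where "\<delta> = \<epsilon> / 2"
  have \<delta>: "\<delta> > 0" using eps by (simp add: \<delta>_def)
  define F where "F = {n :: int ^ 'd. nsq n < 24 / \<delta>}"
  define W where "W n = (if n \<in> F then 24 else 0 :: real)" for n
  define C where "C = 24 * real (card F) + 640"
  have C: "C > 0" by (simp add: C_def)
  obtain K where K: "harm K \<ge> 112 * C / \<delta>"
    using harm_at_top unfolding filterlim_at_top eventually_sequentially by blast
  obtain M0 where "\<And>M. M \<ge> M0 \<Longrightarrow> harm M \<ge> 2 * (harm K :: real)"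
    using harm_at_top unfolding filterlim_at_top eventually_sequentially by blast
  hence M: "2 * (harm K :: real) \<le> harm (Suc M0)" by simp
  define u where "u = cutoff_profile (Suc M0)"
  have u: "u \<in> test_functions" unfolding u_def by (rule cutoff_profile_test_function) simp
  have "harm K / 112 \<le> hardy_term u"
    unfolding u_def using M by (intro hardy_term_cutoff_profile) auto
  hence "\<delta> * harm K \<le> \<delta> * (112 * hardy_term u)" using \<delta> by (intro mult_left_mono) auto
  moreover have "112 * C \<le> \<delta> * harm K" using K \<delta> by (simp add: divide_le_eq mult.commute)
  ultimately have D: "C \<le> \<delta> * hardy_term u" by linarith
  have "weighted_mass W u \<le> 24 * real (card F)"
  proof -
    have fin: "finite F" unfolding F_def by (rule finite_nsq_less)
    have "weighted_mass W u = infsum (\<lambda>n. W n * (cmod (u n))\<^sup>2) (F - {0})"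
      unfolding weighted_mass_def by (intro infsum_cong_neutral) (auto simp: W_def punctured_lattice_def)
    also have "\<dots> = (\<Sum>n\<in>F - {0}. 24 * (cmod (u n))\<^sup>2)"
      using fin by (simp add: W_def)
    also have "\<dots> \<le> (\<Sum>n\<in>F - {0}. 24)"
    proof (rule sum_mono)
      fix n
      have "cmod (u n) \<le> 1 * 1" unfolding u_def cmod_cutoff_profile
        using h_le_1 h_nonneg harm_cutoff_range by (intro mult_mono) auto
      hence "(cmod (u n))\<^sup>2 \<le> 1" by (simp add: power_le_one)
      thus "24 * (cmod (u n))\<^sup>2 \<le> 24" by simp
    qed
    also have "\<dots> \<le> 24 * real (card F)" using card_mono[OF fin, of "F - {0}"] by simp
    finally show ?thesis .
  qed
  moreover have "weighted_mass lap_quot u \<le> weighted_mass (\<lambda>n. (A_const CARD('d) + \<delta>) * (1 / nsq n) + W n) u"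
  proof (rule weighted_mass_mono[OF u])
    fix n :: "int ^ 'd" assume n: "n \<noteq> 0"
    have m: "nsq n \<ge> 1" by (rule nsq_ge_1[OF n])
    have "24 / (nsq n)\<^sup>2 \<le> \<delta> * (1 / nsq n) + W n"
    proof (cases "n \<in> F")
      case True
      have "(nsq n)\<^sup>2 \<ge> 1" using m by (rule one_le_power)
      hence "24 / (nsq n)\<^sup>2 \<le> 24" by (simp add: divide_le_eq)
      moreover have "0 \<le> \<delta> * (1 / nsq n)" using \<delta> m by simp
      ultimately show ?thesis using True by (simp add: W_def)
    next
      case False
      hence "24 \<le> \<delta> * nsq n" using \<delta> by (simp add: F_def field_simps)
      hence "24 / (nsq n)\<^sup>2 \<le> \<delta> * nsq n / (nsq n)\<^sup>2" by (intro divide_right_mono) auto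
      also have "\<delta> * x / x\<^sup>2 = \<delta> * (1 / x)" for x :: real by (simp add: power2_eq_square)
      finally show ?thesis using False by (simp add: W_def)
    qed
    thus "lap_quot n \<le> (A_const CARD('d) + \<delta>) * (1 / nsq n) + W n"
      using lap_quot_upper[OF n] by (simp add: add_divide_distrib)
  qed
  moreover have "weighted_mass (\<lambda>n. (A_const CARD('d) + \<delta>) * (1 / nsq n) + W n) u
      = (A_const CARD('d) + \<delta>) * hardy_term u + weighted_mass W u"
    unfolding weighted_mass_add[OF u] weighted_mass_cmult[OF u] hardy_term_eq ..
  moreover have "ground_energy h u \<le> 640" unfolding u_def by (rule ground_energy_cutoff_profile) simp
  moreover have "energy u = weighted_mass lap_quot u + ground_energy h u"
    using ground_state_identity[of h u, OF h_0 h_pos u] unfolding lap_quot_def .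
  ultimately have "energy u \<le> (A_const CARD('d) + \<delta>) * hardy_term u + \<delta> * hardy_term u"
    using D unfolding C_def by linarith
  also have "\<dots> = (A_const CARD('d) + \<epsilon>) * hardy_term u" by (simp add: \<delta>_def algebra_simps)
  finally have "energy u \<le> (A_const CARD('d) + \<epsilon>) * hardy_term u" .
  moreover have "hardy_term u > 0" using less_le_trans[OF C D] \<delta> by (simp add: zero_less_mult_iff)
  ultimately show ?thesis using u by blast
qed

section \<open>Hardy inequality, sharpness and subcriticality\<close>

lemma remainder_weight_eq: "remainder_weight h n = lap_quot n - A_const CARD('d) / nsq n"
  unfolding remainder_weight_def lap_quot_def ..

lemma remainder_weight_pos: "n \<noteq> 0 \<Longrightarrow> 0 < remainder_weight h n"
  unfolding remainder_weight_eq using lap_quot_gt[of n] by simp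

lemma lap_quot_hardy:
  assumes "u \<in> test_functions"
  shows "weighted_mass lap_quot u \<le> energy u"
  using ground_state_identity[of h u, OF h_0 h_pos assms] ground_energy_nonneg[of h u, OF h_nonneg]
  unfolding lap_quot_def by simp

lemma improved_hardy:
  assumes u: "u \<in> test_functions"
  shows "weighted_mass (remainder_weight h) u + A_const CARD('d) * hardy_term u \<le> energy u"
proof -
  have "weighted_mass (remainder_weight h) u + A_const CARD('d) * hardy_term u
      = weighted_mass (\<lambda>n. remainder_weight h n + A_const CARD('d) * (1 / nsq n)) u"
    unfolding hardy_term_eq weighted_mass_add[OF u] weighted_mass_cmult[OF u] ..
  also have "\<dots> = weighted_mass lap_quot u"
    by (rule weighted_mass_cong) (simp add: remainder_weight_eq)
  finally show ?thesis using lap_quot_hardy[OF u] by simp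
qed

lemma energy_ge_hardy_term:
  fixes u :: "int ^ 'd \<Rightarrow> complex"
  assumes "u \<in> test_functions"
  shows "A_const CARD('d) * hardy_term u \<le> energy u"
proof -
  have "0 \<le> weighted_mass (remainder_weight h) u"
    by (rule weighted_mass_nonneg) (simp add: remainder_weight_pos less_imp_le)
  thus ?thesis using improved_hardy[OF assms] by simp
qed

lemma unit_vec_punctured: "unit_vec j \<in> punctured_lattice"
  by (simp add: punctured_lattice_def unit_vec_def axis_eq_0_iff)

lemma subcritical_hardy_form:
  "subcritical (\<lambda>u :: int ^ 'd \<Rightarrow> complex. energy u - A_const CARD('d) * hardy_term u)"
  unfolding subcritical_def nonneg_form_def
proof (intro conjI ballI quadratic_form_energy_minus_hardy exI[of _ "remainder_weight h"])
  show "0 \<le> energy u - A_const CARD('d) * hardy_term u" if "u \<in> test_functions" for u :: "int ^ 'd \<Rightarrow> complex"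
    using energy_ge_hardy_term[OF that] by simp
  show "0 \<le> remainder_weight h n" if "n \<in> punctured_lattice" for n
    using remainder_weight_pos[of n] that by (simp add: punctured_lattice_def less_imp_le)
  show "\<exists>n\<in>punctured_lattice. remainder_weight h n \<noteq> 0"
    using unit_vec_punctured remainder_weight_pos
    by (intro bexI[of _ "unit_vec undefined"]) (auto simp: punctured_lattice_def less_imp_neq[symmetric])
  show "weighted_mass (remainder_weight h) u \<le> energy u - A_const CARD('d) * hardy_term u"
    if "u \<in> test_functions" for u
    using improved_hardy[OF that] by simp
qed

lemma hardy_term_pos:
  fixes u :: "int ^ 'd \<Rightarrow> complex"
  assumes u: "u \<in> test_functions" and nz: "u \<noteq> (\<lambda>_. 0)"
  shows "hardy_term u > 0"
proof -
  obtain n where n: "u n \<noteq> 0" using nz by auto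
  hence n0: "n \<noteq> 0" using u by (auto simp: test_functions_def)
  have "nsq n > 0" "(cmod (u n))\<^sup>2 > 0" using n nsq_ge_1[OF n0] by auto
  hence "0 < 1 / nsq n * (cmod (u n))\<^sup>2" by (intro mult_pos_pos divide_pos_pos zero_less_one)
  also have "\<dots> = (\<Sum>n\<in>{n}. 1 / nsq n * (cmod (u n))\<^sup>2)" by simp
  also have "\<dots> \<le> hardy_term u"
    unfolding hardy_term_eq weighted_mass_def
    by (rule finite_sum_le_infsum[OF weighted_mass_summable[OF u]]) (auto simp: punctured_lattice_def n0)
  finally show ?thesis .
qed

lemma hardy_const_eq: "hardy_const TYPE('d) = A_const CARD('d)"
proof -
  define R where "R = {energy u / hardy_term u | u :: int ^ 'd \<Rightarrow> complex. u \<in> test_functions \<and> u \<noteq> (\<lambda>_. 0)}"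
  have lower: "A_const CARD('d) \<le> r" if "r \<in> R" for r
    using that hardy_term_pos energy_ge_hardy_term unfolding R_def by (auto simp: pos_le_divide_eq)
  have upper: "\<exists>r\<in>R. r \<le> A_const CARD('d) + \<epsilon>" if "\<epsilon> > 0" for \<epsilon>
  proof -
    obtain u :: "int ^ 'd \<Rightarrow> complex" where u: "u \<in> test_functions" "0 < hardy_term u"
      "energy u \<le> (A_const CARD('d) + \<epsilon>) * hardy_term u"
      using almost_extremal[of \<epsilon>] \<open>\<epsilon> > 0\<close> by blast
    have "u \<noteq> (\<lambda>_. 0)" using u(2) by (auto simp: hardy_term_def)
    hence "energy u / hardy_term u \<in> R" using u(1) unfolding R_def by blast
    moreover have "energy u / hardy_term u \<le> A_const CARD('d) + \<epsilon>"
      using u(2,3) by (simp add: pos_divide_le_eq)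
    ultimately show ?thesis by blast
  qed
  have "Inf R = A_const CARD('d)"
  proof (rule antisym)
    show "A_const CARD('d) \<le> Inf R"
      using upper[of 1] lower by (intro cInf_greatest) auto
    show "Inf R \<le> A_const CARD('d)"
    proof (rule field_le_epsilon)
      fix \<epsilon> :: real assume "\<epsilon> > 0"
      then obtain r where "r \<in> R" "r \<le> A_const CARD('d) + \<epsilon>" using upper by blast
      thus "Inf R \<le> A_const CARD('d) + \<epsilon>"
        using bdd_belowI[of R, OF lower] by (intro cInf_lower2[of r])
    qed
  qed
  thus ?thesis by (simp add: hardy_const_def R_def)
qed

lemma hardy_weight_lap_quot: "hardy_weight lap_quot"
  unfolding hardy_weight_def
proof (intro conjI ballI lap_quot_hardy)
  fix n :: "int ^ 'd" assume "n \<in> punctured_lattice"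
  hence n: "n \<noteq> 0" by (simp add: punctured_lattice_def)
  have "0 \<le> A_const CARD('d) / nsq n" by (simp add: A_eq)
  thus "0 \<le> lap_quot n" using lap_quot_gt[OF n] by simp
qed

lemma hardy_weight_classical: "hardy_weight (\<lambda>n :: int ^ 'd. A_const CARD('d) / nsq n)"
  unfolding hardy_weight_def
proof (intro conjI ballI)
  fix u :: "int ^ 'd \<Rightarrow> complex" assume u: "u \<in> test_functions"
  have "weighted_mass (\<lambda>n. A_const CARD('d) / nsq n) u = A_const CARD('d) * hardy_term u"
    using weighted_mass_cmult[OF u, of "A_const CARD('d)" "\<lambda>n. 1 / nsq n"] by (simp add: hardy_term_eq)
  thus "weighted_mass (\<lambda>n. A_const CARD('d) / nsq n) u \<le> energy u"
    using energy_ge_hardy_term[OF u] by simp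
qed (simp add: A_eq)

lemma not_pointwise_optimal_classical:
  "\<not> pointwise_optimal (\<lambda>n :: int ^ 'd. A_const CARD('d) / nsq n)"
  unfolding pointwise_optimal_def not_not
proof (intro exI[of _ lap_quot] conjI hardy_weight_lap_quot ballI bexI[of _ "unit_vec undefined"] unit_vec_punctured)
  show "A_const CARD('d) / nsq n \<le> lap_quot n" if "n \<in> punctured_lattice" for n
    using lap_quot_gt[of n] that by (simp add: punctured_lattice_def)
  show "lap_quot (unit_vec undefined) \<noteq> A_const CARD('d) / nsq (unit_vec undefined :: int ^ 'd)"
  proof -
    have "unit_vec undefined \<noteq> (0 :: int ^ 'd)"
      using unit_vec_punctured[of undefined] by (simp add: punctured_lattice_def)
    from lap_quot_gt[OF this] show ?thesis by simp
  qed
qed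

end

theorem corollary3p7:
  fixes h :: "int ^ 'd::finite \<Rightarrow> real"
  assumes "(CARD('d) = 3 \<and> h = h3) \<or> (CARD('d) = 4 \<and> h = h4)"
  shows "(\<forall>n\<in>punctured_lattice. 0 < remainder_weight h n) \<and>
    (\<forall>u\<in>test_functions.
       energy u - A_const CARD('d) * hardy_term u \<ge> weighted_mass (remainder_weight h) u) \<and>
    subcritical (\<lambda>u :: int ^ 'd \<Rightarrow> complex. energy u - A_const CARD('d) * hardy_term u) \<and>
    hardy_const TYPE('d) = A_const CARD('d) \<and>
    hardy_weight (\<lambda>n :: int ^ 'd. A_const CARD('d) / (eucl_norm n)\<^sup>2) \<and>
    \<not> pointwise_optimal (\<lambda>n :: int ^ 'd. A_const CARD('d) / (eucl_norm n)\<^sup>2)"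
proof -
  obtain a c where "hardy_profile h a c"
  proof -
    from assms show ?thesis
    proof
      assume "CARD('d) = 3 \<and> h = h3"
      hence "hardy_profile h (1/4) (75/64)" by unfold_locales (auto simp: h3_def)
      thus ?thesis by (rule that)
    next
      assume "CARD('d) = 4 \<and> h = h4"
      hence "hardy_profile h (1/2) (17/8)" by unfold_locales (auto simp: h4_def)
      thus ?thesis by (rule that)
    qed
  qed
  then interpret hardy_profile h a c .
  show ?thesis
  proof (intro conjI ballI)
    show "0 < remainder_weight h n" if "n \<in> punctured_lattice" for n
      using that remainder_weight_pos by (simp add: punctured_lattice_def)
    show "weighted_mass (remainder_weight h) u \<le> energy u - A_const CARD('d) * hardy_term u"
      if "u \<in> test_functions" for u
      using improved_hardy[OF that] by simp
  qed (rule subcritical_hardy_form hardy_const_eq hardy_weight_classical not_pointwise_optimal_classical)+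
qed

end
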